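(* Let $b\ge 3$ be an integer, let $x(b)=\sum_{j=0}^\infty \frac{1}{b^{2^j}}$, and let $s_k/t_k$, $k\ge 0$, be the sequence of convergents of the continued fraction expansion of $x(b)$. Then for every integer $i\ge 0$ the sequence $S(s_k/t_k)$, $k\ge 0$, has infinitely many transcendental cluster points in the open interval $$\left(b-10-2i+\frac 1b,\; b-9-2i+\frac 1{b-1}\right).$$
   Context: For a positive integer $n$ and an integer $m$ with $\gcd(m,n)=1$, the classical Dedekind sum is $s(m/n)=\sum_{k=1}^n ((k/n))((mk/n))$, where $((\cdot))$ is the sawtooth function: $((y))=y-\lfloor y\rfloor-\tfrac12$ if $y\in\mathbb R\setminus\mathbb Z$ and $((y))=0$ if $y\in\mathbb Z$. Put $S(m/n)=12\,s(m/n)$. For an irrational number $x$ with regular continued fraction expansion $[a_0,a_1,a_2,\ldots]$, the convergents $s_k/t_k=[a_0,a_1,\ldots,a_k]$ have numerators and denominators defined by $s_{-2}=0$, $s_{-1}=1$, $s_k=a_ks_{k-1}+s_{k-2}$ and $t_{-2}=1$, $t_{-1}=0$, $t_k=a_kt_{k-1}+t_{k-2}$ for $k\ge 0$. A cluster point of a real sequence is a limit of some subsequence. *)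

theory Defs
  imports "HOL-Analysis.Analysis" "HOL-Computational_Algebra.Polynomial"
begin

definition sawtooth :: "real \<Rightarrow> real" where
  "sawtooth y = (if y \<in> \<int> then 0 else y - of_int \<lfloor>y\<rfloor> - 1 / 2)"

text \<open>
  The classical Dedekind sum \<open>s(m/n)\<close> takes numerator and denominator as separate arguments.
  It is only meant for \<open>n > 0\<close> and \<open>coprime m n\<close>.
\<close>

definition dedekind_sum :: "int \<Rightarrow> int \<Rightarrow> real" where
  "dedekind_sum m n =
     (\<Sum>k = 1..n. sawtooth (of_int k / of_int n) * sawtooth (of_int (m * k) / of_int n))"

definition dedekind_S :: "int \<Rightarrow> int \<Rightarrow> real" where
  "dedekind_S m n = 12 * dedekind_sum m n"

text \<open>
  Regular continued fraction expansion \<open>[a\<^sub>0, a\<^sub>1, a\<^sub>2, \<dots>]\<close> of an irrational number \<open>x\<close>: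
  \<open>cf_complete x k\<close> is the \<open>k\<close>-th complete quotient and \<open>cf_coeff x k\<close> is \<open>a\<^sub>k\<close>.
  For rational \<open>x\<close> the values past the end of the expansion are junk.
\<close>

primrec cf_complete :: "real \<Rightarrow> nat \<Rightarrow> real" where
  "cf_complete x 0 = x"
| "cf_complete x (Suc k) = 1 / (cf_complete x k - of_int \<lfloor>cf_complete x k\<rfloor>)"

definition cf_coeff :: "real \<Rightarrow> nat \<Rightarrow> int" where
  "cf_coeff x k = \<lfloor>cf_complete x k\<rfloor>"

text \<open>
  The recurrences for the convergents start at index \<open>-2\<close>. The auxiliary sequences are shifted
  by 2, so that \<open>cf_num_shift x (k + 2)\<close> and \<open>cf_den_shift x (k + 2)\<close> are the numerator and the
  denominator of \<open>[a\<^sub>0, \<dots>, a\<^sub>k]\<close>.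
\<close>

fun cf_num_shift :: "real \<Rightarrow> nat \<Rightarrow> int" where
  "cf_num_shift x 0 = 0"
| "cf_num_shift x (Suc 0) = 1"
| "cf_num_shift x (Suc (Suc k)) = cf_coeff x k * cf_num_shift x (Suc k) + cf_num_shift x k"

fun cf_den_shift :: "real \<Rightarrow> nat \<Rightarrow> int" where
  "cf_den_shift x 0 = 1"
| "cf_den_shift x (Suc 0) = 0"
| "cf_den_shift x (Suc (Suc k)) = cf_coeff x k * cf_den_shift x (Suc k) + cf_den_shift x k"

definition cf_num :: "real \<Rightarrow> nat \<Rightarrow> int" where
  "cf_num x k = cf_num_shift x (k + 2)"

definition cf_den :: "real \<Rightarrow> nat \<Rightarrow> int" where
  "cf_den x k = cf_den_shift x (k + 2)"

definition cluster_point :: "(nat \<Rightarrow> real) \<Rightarrow> real \<Rightarrow> bool" where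
  "cluster_point f c \<longleftrightarrow> (\<exists>r. strict_mono r \<and> (f \<circ> r) \<longlonglongrightarrow> c)"

definition x_series :: "nat \<Rightarrow> real" where
  "x_series b = (\<Sum>j. 1 / real b ^ (2 ^ j))"

end

theory Submission
  imports Defs
begin

text \<open>
  Write \<open>x\<close> for the series, \<open>a\<^sub>j\<close> for its partial quotients and
  \<open>L(k) = a\<^sub>1 - a\<^sub>2 + \<dots> \<plusminus> a\<^sub>k\<close>. The formula of Barkan, Hickerson and Knuth
  (\<open>barkan_hickerson_knuth\<close>), a consequence of Dedekind's reciprocity law, says that for odd \<open>k\<close>
  \<open>S(s\<^sub>k/t\<^sub>k) = L(k) - 3 + s\<^sub>k/t\<^sub>k + t\<^sub>k\<^sub>-\<^sub>1/t\<^sub>k\<close>.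
  Here \<open>s\<^sub>k/t\<^sub>k\<close> tends to \<open>x\<close>, and \<open>t\<^sub>k\<^sub>-\<^sub>1/t\<^sub>k\<close> is the continued fraction
  \<open>[0, a\<^sub>k, a\<^sub>k\<^sub>-\<^sub>1, \<dots>, a\<^sub>1]\<close>. So a subsequence along which \<open>L\<close> is constant and the expansion
  converges when read backwards gives a cluster point.

  Such subsequences come from the folding symmetry of \<open>x\<close>: passing from the partial sum with
  denominator \<open>q = b^2^n\<close> to the next one adds \<open>1/q\<^sup>2\<close>, which on the level of continued fractions
  appends the mirror image of the word, up to a change of the two middle letters. Hence for
  \<open>m = 2^n \<ge> 4\<close> the expansion is almost symmetric about the gap between \<open>m\<close> and \<open>m + 1\<close>:
  \<open>a\<^sub>2\<^sub>m\<^sub>-\<^sub>k = a\<^sub>k\<^sub>+\<^sub>1\<close>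
  (\<open>cf_coeff_x_series_reflect\<close>). It follows that \<open>L(2m - k) = L(k) - 2\<close>, and that
  for \<open>K = 2m - k\<close> the number \<open>t\<^sub>K\<^sub>-\<^sub>1/t\<^sub>K\<close> tends to the tail
  \<open>\<xi>\<^sub>k = [0, a\<^sub>k\<^sub>+\<^sub>1, a\<^sub>k\<^sub>+\<^sub>2, \<dots>]\<close> as \<open>n\<close> grows. So every odd \<open>k\<close> yields
  the cluster point \<open>L(k) - 5 + x + \<xi>\<^sub>k\<close> (\<open>dedekind_S_cluster_point\<close>).

  Since \<open>L(1) = b - 1\<close> and reflection lowers \<open>L\<close> by 2 in infinitely many ways, there are infinitely
  many odd \<open>k\<close> with \<open>L(k) = b - 1 - 2(i + 2)\<close>; for these the cluster point is
  \<open>b - 10 - 2i + x + \<xi>\<^sub>k\<close>, and the bounds \<open>1/b < x < 1/(b - 1)\<close> and \<open>0 < \<xi>\<^sub>k < 1\<close>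
  place it in the required interval. As \<open>\<xi>\<^sub>k\<close> is a Moebius transform of \<open>x\<close> with integer
  coefficients and denominator of degree one, \<open>x + \<xi>\<^sub>k\<close> is a nonconstant rational function of \<open>x\<close>,
  and \<open>\<xi>\<^sub>k = \<xi>\<^sub>l\<close> for \<open>k \<noteq> l\<close> would be a quadratic equation for \<open>x\<close>. Both the
  transcendence and the distinctness of the limits therefore reduce to the transcendence of \<open>x\<close>
  (\<open>x_series_transcendental\<close>). This is proved by Knight's argument: in base \<open>b\<close>, a polynomial
  expression in \<open>x\<close> has nonzero digits that are isolated by long stretches of zeros.
\<close>

unbundle no vec_syntax
unbundle fps_syntax

section \<open>Transcendence of the lacunary series\<close>

fun binary_ones :: "nat \<Rightarrow> nat" where
  "binary_ones n = (if n = 0 then 0 else n mod 2 + binary_ones (n div 2))"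

declare binary_ones.simps [simp del]

lemma binary_ones_0 [simp]: "binary_ones 0 = 0"
  by (simp add: binary_ones.simps)

lemma binary_ones_rec: "binary_ones n = n mod 2 + binary_ones (n div 2)"
  by (cases "n = 0") (simp_all add: binary_ones.simps[of n])

lemma binary_ones_1 [simp]: "binary_ones (Suc 0) = 1"
  using binary_ones_rec[of 1] by simp

lemma binary_ones_double [simp]: "binary_ones (2 * n) = binary_ones n"
  using binary_ones_rec[of "2 * n"] by simp

lemma binary_ones_double_Suc [simp]: "binary_ones (Suc (2 * n)) = Suc (binary_ones n)"
  using binary_ones_rec[of "Suc (2 * n)"] by simp

lemma binary_ones_pos: "n > 0 \<Longrightarrow> binary_ones n > 0"
proof (induction n rule: less_induct)
  case (less n)
  show ?case
  proof (cases "odd n")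
    case True
    then show ?thesis using binary_ones_rec[of n] by (simp add: odd_iff_mod_2_eq_one)
  next
    case False
    then have "n div 2 > 0" "n div 2 < n" using less.prems by auto
    then show ?thesis using less.IH[of "n div 2"] binary_ones_rec[of n] by simp
  qed
qed

lemma binary_ones_Suc_le: "binary_ones (Suc n) \<le> Suc (binary_ones n)"
proof (induction n rule: less_induct)
  case (less n)
  show ?case
  proof (cases "even n")
    case True
    then obtain k where "n = 2 * k" by (elim evenE)
    then show ?thesis by simp
  next
    case False
    then obtain k where k: "n = Suc (2 * k)" by (elim oddE) simp
    have "Suc n = 2 * Suc k" using k by simp
    then have "binary_ones (Suc n) = binary_ones (Suc k)" by (simp only: binary_ones_double)
    also have "\<dots> \<le> Suc (binary_ones k)" using less.IH[of k] k by simp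
    finally show ?thesis using k by simp
  qed
qed

text \<open>
  Adding a power of two flips a block of ones followed by a zero, so it creates at most one new
  one. Hence a sum of \<open>d\<close> powers of two has at most \<open>d\<close> ones.
\<close>

lemma binary_ones_add_power2_le: "binary_ones (n + 2 ^ j) \<le> Suc (binary_ones n)"
proof (induction j arbitrary: n)
  case 0
  then show ?case by (simp add: binary_ones_Suc_le)
next
  case (Suc j)
  have "(n + 2 ^ Suc j) mod 2 = n mod 2" "(n + 2 ^ Suc j) div 2 = n div 2 + 2 ^ j"
    by simp_all
  then show ?case using Suc.IH[of "n div 2"] binary_ones_rec[of n] binary_ones_rec[of "n + 2 ^ Suc j"]
    by (simp add: add.commute)
qed

lemma binary_ones_shift_add: "k < 2 ^ m \<Longrightarrow> binary_ones (2 ^ m * q + k) = binary_ones q + binary_ones k"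
proof (induction m arbitrary: k)
  case 0
  then show ?case by simp
next
  case (Suc m)
  have "k div 2 < 2 ^ m" using Suc.prems by auto
  note IH = Suc.IH[OF this]
  have "2 ^ Suc m * q + k = 2 * (2 ^ m * q) + k" by simp
  then have "(2 ^ Suc m * q + k) mod 2 = k mod 2" "(2 ^ Suc m * q + k) div 2 = 2 ^ m * q + k div 2"
    by (simp_all only:) simp_all
  then show ?case using IH binary_ones_rec[of k] binary_ones_rec[of "2 ^ Suc m * q + k"] by simp
qed

lemma binary_ones_power2_minus_1: "binary_ones (2 ^ d - 1) = d"
proof (induction d)
  case (Suc d)
  have "(1::nat) \<le> 2 ^ d" by simp
  then have "(2::nat) ^ Suc d - 1 = Suc (2 * (2 ^ d - 1))"
    unfolding power_Suc by linarith
  then show ?case using Suc binary_ones_double_Suc by metis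
qed simp

text \<open>
  The coefficient of \<open>z^n\<close> in the \<open>d\<close>-th power of this series counts the ways of writing \<open>n\<close> as
  an ordered sum of \<open>d\<close> powers of two, and its value at \<open>1/b\<close> is \<open>x_series b\<close>.
\<close>

definition pow2_fps :: "real fps" where
  "pow2_fps = Abs_fps (\<lambda>n. if \<exists>j. n = 2 ^ j then 1 else 0)"

lemma pow2_fps_nth: "pow2_fps $ n = (if \<exists>j. n = 2 ^ j then 1 else 0)"
  by (simp add: pow2_fps_def)

lemma pow2_fps_power_Suc_nth:
  "(pow2_fps ^ Suc d) $ n = (\<Sum>i=0..n. pow2_fps $ i * (pow2_fps ^ d) $ (n - i))"
  by (simp only: power_Suc fps_mult_nth)

lemma pow2_fps_power_Ints: "(pow2_fps ^ d) $ n \<in> \<int>"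
proof (induction d arbitrary: n)
  case (Suc d)
  then show ?case
    unfolding pow2_fps_power_Suc_nth by (intro Ints_sum Ints_mult) (auto simp: pow2_fps_nth)
qed auto

lemma pow2_fps_power_nonneg: "(pow2_fps ^ d) $ n \<ge> 0"
proof (induction d arbitrary: n)
  case (Suc d)
  then show ?case
    unfolding pow2_fps_power_Suc_nth by (intro sum_nonneg mult_nonneg_nonneg) (auto simp: pow2_fps_nth)
qed auto

lemma pow2_fps_power_le: "(pow2_fps ^ d) $ n \<le> real (n + 1) ^ d"
proof (induction d arbitrary: n)
  case (Suc d)
  have "(pow2_fps ^ Suc d) $ n \<le> (\<Sum>i=0..n. 1 * real (n + 1) ^ d)"
    unfolding pow2_fps_power_Suc_nth
  proof (intro sum_mono mult_mono)
    fix i assume "i \<in> {0..n}"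
    have "(pow2_fps ^ d) $ (n - i) \<le> real (n - i + 1) ^ d" by (rule Suc)
    also have "\<dots> \<le> real (n + 1) ^ d" by (intro power_mono) auto
    finally show "(pow2_fps ^ d) $ (n - i) \<le> real (n + 1) ^ d" .
  qed (auto simp: pow2_fps_nth pow2_fps_power_nonneg)
  then show ?case by simp
qed auto

lemma pow2_fps_power_eq_0:
  assumes "d < binary_ones n"
  shows "(pow2_fps ^ d) $ n = 0"
  using assms
proof (induction d arbitrary: n)
  case 0
  then show ?case by (cases "n = 0") auto
next
  case (Suc d)
  have "pow2_fps $ i * (pow2_fps ^ d) $ (n - i) = 0" if "i \<le> n" for i
  proof (cases "\<exists>j. i = 2 ^ j")
    case True
    then obtain j where j: "i = 2 ^ j" by blast
    have "binary_ones n \<le> Suc (binary_ones (n - i))"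
      using binary_ones_add_power2_le[of "n - i" j] that j by simp
    then show ?thesis using Suc by simp
  qed (simp add: pow2_fps_nth)
  then show ?case unfolding pow2_fps_power_Suc_nth by (intro sum.neutral) auto
qed

lemma pow2_fps_power_ge_1: "(pow2_fps ^ d) $ (2 ^ m * (2 ^ d - 1)) \<ge> 1"
proof (induction d)
  case (Suc d)
  let ?N = "2 ^ m * (2 ^ Suc d - 1) :: nat"
  have N: "?N - 2 ^ (m + d) = 2 ^ m * (2 ^ d - 1)" "2 ^ (m + d) \<le> ?N"
  proof -
    have "2 ^ Suc d - 1 = 2 ^ d + (2 ^ d - 1 :: nat)" by simp
    then have "?N = 2 ^ (m + d) + 2 ^ m * (2 ^ d - 1)"
      by (simp only: distrib_left power_add)
    then show "?N - 2 ^ (m + d) = 2 ^ m * (2 ^ d - 1)" "2 ^ (m + d) \<le> ?N" by simp_all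
  qed
  have "1 \<le> pow2_fps $ (2 ^ (m + d)) * (pow2_fps ^ d) $ (?N - 2 ^ (m + d))"
    using Suc unfolding N(1) by (auto simp: pow2_fps_nth)
  also have "\<dots> \<le> (\<Sum>i=0..?N. pow2_fps $ i * (pow2_fps ^ d) $ (?N - i))"
    using N(2)
    by (intro member_le_sum[of _ _ "\<lambda>i. pow2_fps $ i * (pow2_fps ^ d) $ (?N - i)"])
       (auto intro!: mult_nonneg_nonneg pow2_fps_power_nonneg simp: pow2_fps_nth)
  finally show ?case unfolding pow2_fps_power_Suc_nth .
qed auto

text \<open>
  Ratio test: the quotient of consecutive terms tends to \<open>z\<close>.
\<close>

lemma summable_poly_times_geometric:
  fixes z :: real
  assumes "0 < z" "z < 1" "0 < a" "0 < c"
  shows "summable (\<lambda>n. C * (a * real n + c) ^ D * z ^ n)"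
proof -
  let ?g = "\<lambda>n. (a * real n + c) ^ D * z ^ n"
  have "(\<lambda>n. (a * real (Suc n) + c) / (a * real n + c)) \<longlonglongrightarrow> 1"
  proof -
    have lim: "filterlim (\<lambda>n. a * real n + c) at_top sequentially"
      using filterlim_tendsto_add_at_top[OF tendsto_const[of c]
          filterlim_tendsto_pos_mult_at_top[OF tendsto_const[of a] \<open>0 < a\<close> filterlim_real_sequentially]]
      by (simp add: add.commute)
    have "(\<lambda>n. 1 + a * inverse (a * real n + c)) \<longlonglongrightarrow> 1 + a * 0"
      by (intro tendsto_intros tendsto_inverse_0_at_top lim)
    moreover have "(a * real (Suc n) + c) / (a * real n + c) = 1 + a * inverse (a * real n + c)" for n
    proof -
      have "a * real n + c > 0" using assms by (intro add_nonneg_pos) auto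
      then show ?thesis by (simp add: field_simps)
    qed
    ultimately show ?thesis by simp
  qed
  then have lim: "(\<lambda>n. ((a * real (Suc n) + c) / (a * real n + c)) ^ D * z) \<longlonglongrightarrow> 1 ^ D * z"
    by (intro tendsto_intros)
  define q where "q = (1 + z) / 2"
  have q: "1 ^ D * z < q" "q < 1" using assms by (simp_all add: q_def)
  obtain N where N: "\<And>n. n \<ge> N \<Longrightarrow> ((a * real (Suc n) + c) / (a * real n + c)) ^ D * z < q"
    using order_tendstoD(2)[OF lim q(1)] unfolding eventually_sequentially by blast
  have "summable ?g"
  proof (rule summable_ratio_test[OF q(2)])
    fix n assume n: "n \<ge> N"
    have pos: "a * real n + c > 0" "a * real (Suc n) + c > 0"
      using assms by (auto intro!: add_nonneg_pos)
    have "?g (Suc n) = ((a * real (Suc n) + c) / (a * real n + c)) ^ D * z * ?g n"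
      using pos by (simp add: power_divide)
    also have "\<dots> \<le> q * ?g n"
      using N[OF n] pos assms by (intro mult_right_mono) auto
    finally show "norm (?g (Suc n)) \<le> q * norm (?g n)"
      using pos assms by (simp add: abs_mult)
  qed
  then show ?thesis using summable_mult[of ?g C] by (simp add: mult.assoc)
qed

text \<open>
  The gap principle behind the transcendence proof. Let a series with integer coefficients of
  polynomial growth vanish at \<open>z = 1/b\<close>, and let an index \<open>N\<close> be separated from the other nonzero
  coefficients by \<open>M\<close> on both sides, with \<open>N\<close> bounded by a multiple of \<open>M\<close>. Scaling by
  \<open>b^(N - M)\<close> turns the part below \<open>N\<close> into an integer, while the part from \<open>N\<close> on becomes
  smaller than 1 once \<open>M\<close> is large; so both vanish. Scaling the latter by \<open>b^M\<close> more, the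
  coefficient at \<open>N\<close> is itself an integer of absolute value less than 1.
\<close>

lemma coeff_between_gaps_eq_0:
  fixes R :: "nat \<Rightarrow> real" and z :: real
  assumes z: "0 < z" "z < 1" "1 / z \<in> \<int>"
    and R_Ints: "\<And>n. R n \<in> \<int>"
    and R_le: "\<And>n. \<bar>R n\<bar> \<le> C * real (n + 1) ^ D"
    and R_sums: "(\<lambda>n. R n * z ^ n) sums 0"
  shows "\<exists>M0. \<forall>M\<ge>M0. \<forall>N. M \<le> N \<longrightarrow> N \<le> K * M \<longrightarrow>
           (\<forall>n. N < n + M \<and> n < N \<longrightarrow> R n = 0) \<longrightarrow>
           (\<forall>n. N < n \<and> n < N + M \<longrightarrow> R n = 0) \<longrightarrow> R N = 0"
proof -
  define h where "h = (\<lambda>j. C * ((real K + 1) * real j + 1) ^ D * z ^ j)"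
  have h_summable: "summable h"
    unfolding h_def using z by (intro summable_poly_times_geometric) auto
  obtain M0 where M0: "\<And>M. M \<ge> M0 \<Longrightarrow> norm (\<Sum>i. h (i + M)) < 1"
    using suminf_exist_split[OF _ h_summable, of 1] by auto
  have C: "C \<ge> 0" using R_le[of 0] by simp
  have h_bound: "\<bar>R n * z ^ j\<bar> \<le> h j" if "n \<le> (K + 1) * j" for n j
  proof -
    have "real n \<le> real ((K + 1) * j)" using that by (intro of_nat_mono)
    then have "real (n + 1) \<le> (real K + 1) * real j + 1" by (simp add: algebra_simps)
    then have "C * real (n + 1) ^ D \<le> C * ((real K + 1) * real j + 1) ^ D"
      using C by (intro mult_left_mono power_mono) auto
    then have "\<bar>R n\<bar> \<le> C * ((real K + 1) * real j + 1) ^ D"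
      using R_le[of n] by linarith
    then show ?thesis unfolding h_def using z by (simp add: abs_mult mult_right_mono)
  qed
  have tail: "summable (\<lambda>i. R (i + n) * z ^ (i + M))" (is ?A)
             "\<bar>\<Sum>i. R (i + n) * z ^ (i + M)\<bar> < 1" (is ?B)
    if "n \<le> (K + 1) * M" "M \<ge> M0" for n M
  proof -
    have le: "norm (R (i + n) * z ^ (i + M)) \<le> h (i + M)" for i
      using h_bound[of "i + n" "i + M"] that by (simp add: algebra_simps)
    have h': "summable (\<lambda>i. h (i + M))" using h_summable by (simp add: summable_iff_shift)
    show ?A by (rule summable_comparison_test'[OF h' le])
    have "norm (\<Sum>i. R (i + n) * z ^ (i + M)) \<le> (\<Sum>i. h (i + M))"
      by (rule norm_suminf_le[OF le h'])
    then show ?B using M0[OF that(2)] by simp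
  qed
  show ?thesis
  proof (intro exI[of _ "Suc M0"] allI impI)
    fix M N
    assume M: "M \<ge> Suc M0" and N: "M \<le> N" "N \<le> K * M"
      and below: "\<forall>n. N < n + M \<and> n < N \<longrightarrow> R n = 0"
      and above: "\<forall>n. N < n \<and> n < N + M \<longrightarrow> R n = 0"
    define T where "T = (\<Sum>i. R (i + N) * z ^ (i + M))"
    have T: "summable (\<lambda>i. R (i + N) * z ^ (i + M))" "\<bar>T\<bar> < 1"
      unfolding T_def using tail[of N M] N M by simp_all
    \<comment> \<open>Integral, because the coefficients with \<open>N - M < n < N\<close> vanish.\<close>
    define I where "I = (\<Sum>n<N. R n * z ^ n) / z ^ (N - M)"
    have "I \<in> \<int>"
      unfolding I_def sum_divide_distrib
    proof (intro Ints_sum)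
      fix n assume n: "n \<in> {..<N}"
      show "R n * z ^ n / z ^ (N - M) \<in> \<int>"
      proof (cases "n \<le> N - M")
        case True
        then have "z ^ (N - M) = z ^ n * z ^ (N - M - n)"
          by (metis le_add_diff_inverse power_add)
        then have "z ^ n / z ^ (N - M) = (1 / z) ^ (N - M - n)"
          using z by (simp add: power_divide)
        then show ?thesis using z(3) R_Ints[of n]
          by (metis Ints_mult Ints_power times_divide_eq_right)
      next
        case False
        then have "R n = 0" using below n by auto
        then show ?thesis by simp
      qed
    qed
    moreover have "I = - T"
    proof -
      have "(\<Sum>n. R (n + N) * z ^ (n + N)) + (\<Sum>n<N. R n * z ^ n) = 0"
        using suminf_split_initial_segment[OF sums_summable[OF R_sums], of N] sums_unique[OF R_sums]
        by simp
      moreover have "(\<Sum>n. R (n + N) * z ^ (n + N)) = z ^ (N - M) * T"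
      proof -
        have "R (n + N) * z ^ (n + N) = z ^ (N - M) * (R (n + N) * z ^ (n + M))" for n
        proof -
          have "n + N = (N - M) + (n + M)" using N by simp
          then have "z ^ (n + N) = z ^ (N - M) * z ^ (n + M)" by (metis power_add)
          then show ?thesis by (simp only: mult.left_commute)
        qed
        then show ?thesis unfolding T_def by (simp only: suminf_mult[OF T(1)])
      qed
      ultimately have "(\<Sum>n<N. R n * z ^ n) = - (z ^ (N - M) * T)" by linarith
      then show ?thesis unfolding I_def using z by simp
    qed
    ultimately have T0: "T = 0"
      using T(2) by (metis Ints_nonzero_abs_less1 abs_minus_cancel neg_equal_0_iff_equal)
    show "R N = 0"
    proof -
      have False: "M \<noteq> 0" using M by simp
      let ?T' = "\<Sum>i. R (i + (N + M)) * z ^ (i + M)"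
      have T': "summable (\<lambda>i. R (i + (N + M)) * z ^ (i + M))" "\<bar>?T'\<bar> < 1"
        using tail[of "N + M" M] N M by simp_all
      have "T = (\<Sum>i. R (i + M + N) * z ^ (i + M + M)) + (\<Sum>i<M. R (i + N) * z ^ (i + M))"
        unfolding T_def by (rule suminf_split_initial_segment[OF T(1)])
      also have "(\<Sum>i<M. R (i + N) * z ^ (i + M)) = (\<Sum>i\<in>{0}. R (i + N) * z ^ (i + M))"
        using False above by (intro sum.mono_neutral_right) auto
      also have "\<dots> = z ^ M * R N" by simp
      also have "(\<Sum>i. R (i + M + N) * z ^ (i + M + M)) = z ^ M * ?T'"
      proof -
        have "R (i + M + N) * z ^ (i + M + M) = z ^ M * (R (i + (N + M)) * z ^ (i + M))" for i
          by (simp add: power_add algebra_simps)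
        then show ?thesis by (simp only: suminf_mult[OF T'(1)])
      qed
      finally have "R N = - ?T'" using T0 z
        by (simp add: eq_neg_iff_add_eq_0 add.commute flip: distrib_left)
      then show ?thesis using T'(2) R_Ints[of N]
        by (metis Ints_nonzero_abs_less1 abs_minus_cancel)
    qed
  qed
qed

text \<open>
  The upper estimate comes from comparing \<open>2 ^ j\<close> with \<open>j + 1\<close>, that is, the lacunary series with
  a geometric one.
\<close>

lemma power2_series:
  fixes y :: real
  assumes "0 < y" "y < 1"
  shows "summable (\<lambda>j. y ^ (2 ^ j))" "y < (\<Sum>j. y ^ (2 ^ j))" "(\<Sum>j. y ^ (2 ^ j)) \<le> y / (1 - y)"
proof -
  have le: "y ^ (2 ^ j) \<le> y * y ^ j" for j
  proof -
    have "Suc j \<le> 2 ^ j" by (simp add: Suc_leI)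
    then have "y ^ (2 ^ j) \<le> y ^ Suc j" using assms by (intro power_decreasing) auto
    then show ?thesis by simp
  qed
  have geo: "(\<lambda>j. y * y ^ j) sums (y / (1 - y))"
    using sums_mult[OF geometric_sums[of y], of y] assms by simp
  show sm: "summable (\<lambda>j. y ^ (2 ^ j))"
    by (rule summable_comparison_test'[OF sums_summable[OF geo], of 0]) (use le assms in auto)
  show "(\<Sum>j. y ^ (2 ^ j)) \<le> y / (1 - y)"
    using suminf_le[OF le sm sums_summable[OF geo]] sums_unique[OF geo] by simp
  have "0 < (\<Sum>j. y ^ (2 ^ Suc j))"
    using assms sm summable_Suc_iff[of "\<lambda>j. y ^ (2 ^ j)"] by (intro suminf_pos) auto
  then show "y < (\<Sum>j. y ^ (2 ^ j))"
    using suminf_split_head[OF sm] by simp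
qed

lemma x_series_altdef: "x_series b = (\<Sum>j. (1 / real b) ^ (2 ^ j))"
  by (simp add: x_series_def power_divide)

lemma pow2_fps_power_sums:
  assumes "b \<ge> 2"
  shows "(\<lambda>n. (pow2_fps ^ d) $ n * (1 / real b) ^ n) sums (x_series b ^ d)"
proof (induction d)
  case 0
  have "(\<lambda>n. if n = 0 then 1 else 0 :: real) sums 1"
    using sums_single[of 0 "\<lambda>_. 1 :: real"] by simp
  moreover have "(\<lambda>n. (pow2_fps ^ 0) $ n * (1 / real b) ^ n) = (\<lambda>n. if n = 0 then 1 else 0)"
    by (rule ext) simp
  ultimately show ?case by (simp only: power_0)
next
  case (Suc d)
  let ?z = "1 / real b"
  have z: "0 < ?z" "?z < 1" using assms by simp_all
  have "(\<lambda>j. ?z ^ (2 ^ j)) sums x_series b"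
    using summable_sums[OF power2_series(1)[OF z]] by (simp add: x_series_altdef)
  moreover have "pow2_fps $ (2 ^ j) = 1" for j
    by (auto simp: pow2_fps_nth)
  ultimately have "(\<lambda>j. pow2_fps $ (2 ^ j) * ?z ^ (2 ^ j)) sums x_series b"
    by simp
  then have one: "(\<lambda>n. pow2_fps $ n * ?z ^ n) sums x_series b"
    by (subst (asm) sums_mono_reindex) (auto simp: strict_mono_def pow2_fps_nth)
  have "(\<lambda>n. \<Sum>i\<le>n. (pow2_fps $ i * ?z ^ i) * ((pow2_fps ^ d) $ (n - i) * ?z ^ (n - i)))
          sums ((\<Sum>n. pow2_fps $ n * ?z ^ n) * (\<Sum>n. (pow2_fps ^ d) $ n * ?z ^ n))"
    using sums_summable[OF one] sums_summable[OF Suc.IH] pow2_fps_power_nonneg[of 1]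
    by (intro Cauchy_product_sums) (auto simp: abs_mult pow2_fps_power_nonneg)
  moreover have "(\<Sum>i\<le>n. (pow2_fps $ i * ?z ^ i) * ((pow2_fps ^ d) $ (n - i) * ?z ^ (n - i)))
                   = (pow2_fps ^ Suc d) $ n * ?z ^ n" for n
    unfolding pow2_fps_power_Suc_nth sum_distrib_right atLeast0AtMost
  proof (rule sum.cong[OF refl])
    fix i assume "i \<in> {..n}"
    then have "?z ^ n = ?z ^ i * ?z ^ (n - i)" by (simp flip: power_add)
    then show "(pow2_fps $ i * ?z ^ i) * ((pow2_fps ^ d) $ (n - i) * ?z ^ (n - i))
                 = pow2_fps $ i * (pow2_fps ^ d) $ (n - i) * ?z ^ n"
      by (simp only: mult_ac)
  qed
  ultimately show ?case
    using sums_unique[OF one] sums_unique[OF Suc.IH] by simp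
qed

text \<open>
  A polynomial \<open>p\<close> of degree \<open>d\<close> evaluated at the generating series has \<open>n\<close>-th coefficient
  \<open>R n\<close>, which vanishes if \<open>n\<close> has more than \<open>d\<close> binary ones. The index
  \<open>N = 2^(m+1) (2^d - 1)\<close> has exactly \<open>d\<close> ones, so there only the leading coefficient of \<open>p\<close>
  contributes, and \<open>R N \<noteq> 0\<close>. Its neighbours within distance \<open>2^m\<close> have more than \<open>d\<close> ones:
  above \<open>N\<close> because ones are added in the empty low positions, below \<open>N\<close> because the lowest one of
  \<open>N\<close> is replaced by at least two. The gap principle now contradicts \<open>R N \<noteq> 0\<close>.
\<close>

theorem x_series_transcendental:
  assumes "b \<ge> 2"
  shows "\<not> algebraic (x_series b)"
proof
  let ?x = "x_series b" and ?z = "1 / real b"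
  assume "algebraic ?x"
  then obtain p where p: "\<And>i. coeff p i \<in> \<int>" "p \<noteq> 0" "poly p ?x = 0"
    using algebraicE by blast
  have "degree p \<noteq> 0"
  proof
    assume "degree p = 0"
    then obtain c where "p = [:c:]" using degree_eq_zeroE by blast
    then show False using p by simp
  qed
  then obtain e where e: "degree p = Suc e" using not0_implies_Suc by blast
  define R where "R = (\<lambda>n. \<Sum>d\<le>degree p. coeff p d * (pow2_fps ^ d) $ n)"
  have R_eq_0: "R n = 0" if "degree p < binary_ones n" for n
    unfolding R_def using that by (intro sum.neutral) (auto intro!: pow2_fps_power_eq_0)
  have R_sums: "(\<lambda>n. R n * ?z ^ n) sums 0"
  proof -
    have "(\<lambda>n. \<Sum>d\<le>degree p. coeff p d * ((pow2_fps ^ d) $ n * ?z ^ n)) sums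
            (\<Sum>d\<le>degree p. coeff p d * ?x ^ d)"
      by (intro sums_sum sums_mult pow2_fps_power_sums assms)
    then show ?thesis using p(3)
      by (simp add: R_def sum_distrib_right mult.assoc poly_altdef)
  qed
  have R_le: "\<bar>R n\<bar> \<le> (\<Sum>d\<le>degree p. \<bar>coeff p d\<bar>) * real (n + 1) ^ degree p" for n
  proof -
    have "\<bar>R n\<bar> \<le> (\<Sum>d\<le>degree p. \<bar>coeff p d * (pow2_fps ^ d) $ n\<bar>)"
      unfolding R_def by (rule sum_abs)
    also have "\<dots> \<le> (\<Sum>d\<le>degree p. \<bar>coeff p d\<bar> * real (n + 1) ^ degree p)"
    proof (rule sum_mono)
      fix d assume d: "d \<in> {..degree p}"
      have "(pow2_fps ^ d) $ n \<le> real (n + 1) ^ d" by (rule pow2_fps_power_le)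
      also have "\<dots> \<le> real (n + 1) ^ degree p" using d by (intro power_increasing) auto
      finally show "\<bar>coeff p d * (pow2_fps ^ d) $ n\<bar> \<le> \<bar>coeff p d\<bar> * real (n + 1) ^ degree p"
        by (simp add: abs_mult pow2_fps_power_nonneg mult_left_mono)
    qed
    finally show ?thesis by (simp add: sum_distrib_right)
  qed
  have R_Ints: "R n \<in> \<int>" for n
    unfolding R_def by (intro Ints_sum Ints_mult p pow2_fps_power_Ints)
  have z: "0 < ?z" "?z < 1" "1 / ?z \<in> \<int>" using assms by simp_all
  obtain m where gap: "\<And>N. 2 ^ m \<le> N \<Longrightarrow> N \<le> 2 ^ Suc (degree p) * 2 ^ m \<Longrightarrow>
           (\<forall>n. N < n + 2 ^ m \<and> n < N \<longrightarrow> R n = 0) \<Longrightarrow>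
           (\<forall>n. N < n \<and> n < N + 2 ^ m \<longrightarrow> R n = 0) \<Longrightarrow> R N = 0"
  proof -
    obtain M0 where M0: "\<forall>M\<ge>M0. \<forall>N. M \<le> N \<longrightarrow> N \<le> 2 ^ Suc (degree p) * M \<longrightarrow>
           (\<forall>n. N < n + M \<and> n < N \<longrightarrow> R n = 0) \<longrightarrow>
           (\<forall>n. N < n \<and> n < N + M \<longrightarrow> R n = 0) \<longrightarrow> R N = 0"
      using coeff_between_gaps_eq_0[OF z R_Ints R_le R_sums, of "2 ^ Suc (degree p)"] by blast
    have "M0 \<le> 2 ^ M0" by simp
    then show ?thesis using M0 by (intro that[of M0]) blast
  qed
  \<comment> \<open>The exponent \<open>Suc m\<close> leaves room for a gap of length \<open>2 ^ m\<close> on both sides.\<close>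
  define N where "N = 2 ^ Suc m * (2 ^ degree p - 1 :: nat)"
  have two: "2 \<le> (2::nat) ^ degree p" using e by simp
  have N: "N = 2 ^ Suc m * (2 ^ degree p - 2) + 2 ^ Suc m"
  proof -
    have "2 ^ degree p - 1 = (2 ^ degree p - 2) + (1::nat)" using two by simp
    then show ?thesis unfolding N_def by (simp only: distrib_left mult_1_right)
  qed
  have "R N = 0"
  proof (rule gap)
    show "2 ^ m \<le> N" unfolding N by simp
    have "N \<le> 2 ^ Suc m * 2 ^ degree p" unfolding N_def by (intro mult_left_mono) auto
    then show "N \<le> 2 ^ Suc (degree p) * 2 ^ m" by (simp add: mult_ac)
    show "\<forall>n. N < n + 2 ^ m \<and> n < N \<longrightarrow> R n = 0"
    proof (intro allI impI R_eq_0)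
      fix n assume n: "N < n + 2 ^ m \<and> n < N"
      define r where "r = n - (2 ^ Suc m * (2 ^ degree p - 2) + 2 ^ m)"
      have r: "0 < r" "r < 2 ^ m" "n = 2 ^ Suc m * (2 ^ degree p - 2) + (2 ^ m * 1 + r)"
        using n power_Suc[of "2::nat" m] unfolding N r_def by linarith+
      have "2 ^ degree p - 2 = 2 * (2 ^ e - 1 :: nat)" using e by (simp add: diff_mult_distrib2)
      then have "binary_ones (2 ^ degree p - 2) = e" by (simp only: binary_ones_double binary_ones_power2_minus_1)
      moreover have "binary_ones (2 ^ m * 1 + r) = Suc (binary_ones r)"
        using binary_ones_shift_add[OF r(2), of 1] by simp
      moreover have "binary_ones n = binary_ones (2 ^ degree p - 2) + binary_ones (2 ^ m * 1 + r)"
        unfolding r(3) using r(2) by (intro binary_ones_shift_add) simp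
      ultimately show "degree p < binary_ones n" using binary_ones_pos[OF r(1)] e by simp
    qed
    show "\<forall>n. N < n \<and> n < N + 2 ^ m \<longrightarrow> R n = 0"
    proof (intro allI impI R_eq_0)
      fix n assume n: "N < n \<and> n < N + 2 ^ m"
      define r where "r = n - N"
      have r: "0 < r" "r < 2 ^ Suc m" "n = 2 ^ Suc m * (2 ^ degree p - 1) + r"
        using n power_Suc[of "2::nat" m] unfolding r_def N_def by linarith+
      have "binary_ones n = degree p + binary_ones r"
        unfolding r(3) using binary_ones_shift_add[OF r(2)] binary_ones_power2_minus_1 by metis
      then show "degree p < binary_ones n" using binary_ones_pos[OF r(1)] by simp
    qed
  qed
  moreover have "R N = coeff p (degree p) * (pow2_fps ^ degree p) $ N"
  proof -
    have "binary_ones N = degree p"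
      using binary_ones_shift_add[of 0 "Suc m" "2 ^ degree p - 1"] binary_ones_power2_minus_1[of "degree p"]
      by (simp add: N_def)
    then have "R N = (\<Sum>d\<in>{degree p}. coeff p d * (pow2_fps ^ d) $ N)"
      unfolding R_def by (intro sum.mono_neutral_right) (auto intro!: pow2_fps_power_eq_0)
    then show ?thesis by simp
  qed
  ultimately show False
    using pow2_fps_power_ge_1[of "degree p" "Suc m"] p(2) unfolding N_def by auto
qed

corollary x_series_irrational: "b \<ge> 2 \<Longrightarrow> x_series b \<notin> \<rat>"
  using x_series_transcendental rat_imp_algebraic by blast

section \<open>Dedekind sums and their reciprocity law\<close>

lemma sawtooth_of_int_divide:
  assumes "n > 0"
  shows "sawtooth (of_int m / of_int n) =
           (if n dvd m then 0 else of_int (m mod n) / of_int n - 1 / 2)"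
proof -
  have "of_int m / of_int n \<in> (\<int> :: real set) \<longleftrightarrow> n dvd m"
  proof
    assume "of_int m / of_int n \<in> (\<int> :: real set)"
    then obtain q where "of_int m / of_int n = (of_int q :: real)" by (elim Ints_cases)
    then have "(of_int m :: real) = of_int (n * q)" using assms by (simp add: field_simps)
    then show "n dvd m" by (simp only: of_int_eq_iff dvd_triv_left)
  next
    assume "n dvd m"
    then show "of_int m / of_int n \<in> (\<int> :: real set)" using assms by (auto elim!: dvdE)
  qed
  moreover have "of_int m / of_int n - of_int (m div n) = (of_int (m mod n) / of_int n :: real)"
    using assms by (simp add: field_simps flip: of_int_mult of_int_add)
  ultimately show ?thesis
    unfolding sawtooth_def by (simp add: floor_divide_of_int_eq)
qed

lemma sawtooth_of_int_divide_cong: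
  assumes "n > 0" "m mod n = m' mod n"
  shows "sawtooth (of_int m / of_int n) = sawtooth (of_int m' / of_int n)"
  using assms by (simp add: sawtooth_of_int_divide dvd_eq_mod_eq_0)

lemma sawtooth_minus: "sawtooth (- y) = - sawtooth y"
proof (cases "y \<in> \<int>")
  case False
  then have "y \<noteq> of_int \<lfloor>y\<rfloor>" by (metis Ints_of_int)
  then have "\<lceil>y\<rceil> = \<lfloor>y\<rfloor> + 1" by (simp add: ceiling_altdef)
  then have "\<lfloor>- y\<rfloor> = - \<lfloor>y\<rfloor> - 1" by (simp add: ceiling_def)
  then show ?thesis using False by (simp add: sawtooth_def minus_in_Ints_iff)
qed (simp add: sawtooth_def minus_in_Ints_iff)

text \<open>
  The summand depends on \<open>k\<close> only modulo \<open>n\<close>; this form is the convenient one for substituting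
  \<open>k\<close> by a multiple of \<open>k\<close>.
\<close>

lemma dedekind_sum_residues:
  assumes "n > 0"
  shows "dedekind_sum m n =
           (\<Sum>k\<in>{0..<n}. sawtooth (of_int k / of_int n) * sawtooth (of_int (m * k) / of_int n))"
proof -
  have "{0..<n} = insert 0 {1..<n}" "{1..n} = insert n {1..<n}" using assms by auto
  moreover have "sawtooth (of_int n / of_int n) = 0" "sawtooth (of_int 0 / of_int n) = 0"
    using assms by (simp_all only: sawtooth_of_int_divide) simp_all
  ultimately show ?thesis by (simp add: dedekind_sum_def)
qed

lemma dedekind_sum_cong:
  assumes "n > 0" "m mod n = m' mod n"
  shows "dedekind_sum m n = dedekind_sum m' n"
  unfolding dedekind_sum_def
proof (intro sum.cong refl arg_cong2[of _ _ _ _ "(*)"] sawtooth_of_int_divide_cong)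
  fix k
  show "(m * k) mod n = (m' * k) mod n" using assms(2) by (metis mod_mult_left_eq)
qed (use assms in simp_all)

lemma bij_betw_mult_mod:
  assumes "n > 0" "coprime a (n::int)"
  shows "bij_betw (\<lambda>k. a * k mod n) {0..<n} {0..<n}"
proof -
  have "inj_on (\<lambda>k. a * k mod n) {0..<n}"
  proof (rule inj_onI)
    fix k l assume kl: "k \<in> {0..<n}" "l \<in> {0..<n}" "a * k mod n = a * l mod n"
    then have "n dvd a * (k - l)" by (simp add: mod_eq_dvd_iff right_diff_distrib)
    then have "n dvd k - l"
      using assms(2) by (simp add: coprime_dvd_mult_right_iff coprime_commute)
    then have "k mod n = l mod n" by (simp add: mod_eq_dvd_iff)
    then show "k = l" using kl by simp
  qed
  moreover have "(\<lambda>k. a * k mod n) ` {0..<n} \<subseteq> {0..<n}" using assms by auto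
  ultimately show ?thesis by (simp add: bij_betw_def endo_inj_surj)
qed

text \<open>
  Substitute \<open>m' k\<close> for \<open>k\<close>: the factor with \<open>m\<close> becomes the sawtooth of \<open>e k / n\<close>, and the
  sawtooth is odd.
\<close>

lemma dedekind_sum_inverse:
  assumes n: "n > 0" and e: "e = 1 \<or> e = -1" and inv: "m * m' mod n = e mod n"
  shows "dedekind_sum m n = of_int e * dedekind_sum m' n"
proof -
  let ?g = "\<lambda>k. sawtooth (of_int k / of_int n)"
  have "coprime m' n"
  proof (rule coprimeI)
    fix d assume d: "d dvd m'" "d dvd n"
    have "n dvd m * m' - e" using inv by (simp add: mod_eq_dvd_iff)
    then have "d dvd m * m' - e" using d(2) dvd_trans by blast
    moreover have "d dvd m * m'" using d(1) by simp
    ultimately have "d dvd m * m' - (m * m' - e)" using dvd_diff by blast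
    then show "is_unit d" using e by auto
  qed
  then have "dedekind_sum m n = (\<Sum>k\<in>{0..<n}. ?g (m' * k mod n) * ?g (m * (m' * k mod n)))"
    unfolding dedekind_sum_residues[OF n]
    by (rule sum.reindex_bij_betw[OF bij_betw_mult_mod[OF n], symmetric])
  also have "\<dots> = (\<Sum>k\<in>{0..<n}. of_int e * (?g k * ?g (m' * k)))"
  proof (rule sum.cong[OF refl])
    fix k
    have "?g (m' * k mod n) = ?g (m' * k)"
      using n by (intro sawtooth_of_int_divide_cong) simp_all
    moreover have "?g (m * (m' * k mod n)) = ?g (e * k)"
    proof (rule sawtooth_of_int_divide_cong[OF n])
      have "m * (m' * k mod n) mod n = (m * m' mod n) * k mod n"
        by (simp add: mod_mult_left_eq mod_mult_right_eq mult.assoc)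
      then show "m * (m' * k mod n) mod n = e * k mod n"
        by (simp add: inv mod_mult_left_eq)
    qed
    moreover have "?g (e * k) = of_int e * ?g k"
      using e by (auto simp: sawtooth_minus)
    ultimately show "?g (m' * k mod n) * ?g (m * (m' * k mod n)) = of_int e * (?g k * ?g (m' * k))"
      by simp
  qed
  finally show ?thesis by (simp add: dedekind_sum_residues[OF n] sum_distrib_left)
qed

lemma int_le_div_iff: "k > 0 \<Longrightarrow> n \<le> m div k \<longleftrightarrow> k * n \<le> (m :: int)"
proof
  assume k: "k > 0"
  {
    assume "n \<le> m div k"
    then have "k * n \<le> k * (m div k)" using k by simp
    also have "\<dots> \<le> m" using k mult_div_mod_eq[of k m] pos_mod_sign[of k m] by linarith
    finally show "k * n \<le> m" .
  next
    assume "k * n \<le> m"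
    then have "k * n div k \<le> m div k" using k by (rule zdiv_mono1)
    then show "n \<le> m div k" using k by simp
  }
qed

definition floor_moment :: "int \<Rightarrow> int \<Rightarrow> int" where
  "floor_moment h k = (\<Sum>\<mu>\<in>{0..<k}. \<mu> * (h * \<mu> div k))"

lemma sum_int_lessThan: "k \<ge> 0 \<Longrightarrow> 2 * (\<Sum>\<mu>\<in>{0..<k}. \<mu>) = k * (k - 1 :: int)"
proof (induction k rule: int_ge_induct)
  case (step k)
  then have "{0..<k + 1} = insert k {0..<k}" by auto
  then show ?case using step by (simp add: algebra_simps)
qed simp

lemma sum_int_squares_lessThan:
  "k \<ge> 0 \<Longrightarrow> 6 * (\<Sum>\<mu>\<in>{0..<k}. \<mu>\<^sup>2) = (k - 1) * k * (2 * k - 1 :: int)"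
proof (induction k rule: int_ge_induct)
  case (step k)
  then have "{0..<k + 1} = insert k {0..<k}" by auto
  then show ?case using step by (simp add: algebra_simps power2_eq_square)
qed simp

text \<open>
  Expanding the product of sawtooth values leaves, besides power sums, only the sum of
  \<open>\<mu> (h \<mu> mod k)\<close>, since the residues \<open>h \<mu> mod k\<close> permute those of \<open>\<mu>\<close>. The term
  for \<open>\<mu> = 0\<close>, where the sawtooth is 0 instead of \<open>- 1/2\<close>, has to be corrected by \<open>1/4\<close>.
\<close>

lemma dedekind_S_eq_floor_moment:
  assumes "k > 0" "coprime h k"
  shows "dedekind_S h k = 2 * of_int (h * (k - 1) * (2 * k - 1)) / of_int k
           - 12 * of_int (floor_moment h k) / of_int k - 3 * of_int (k - 1)"
proof -
  let ?r = "\<lambda>\<mu>. h * \<mu> mod k"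
  have "dedekind_sum h k =
      (\<Sum>\<mu>\<in>{0..<k}. (of_int \<mu> / of_int k - 1 / 2) * (of_int (?r \<mu>) / of_int k - 1 / 2)
                      - (if \<mu> = 0 then 1 / 4 else 0))"
    unfolding dedekind_sum_residues[OF assms(1)]
  proof (rule sum.cong[OF refl])
    fix \<mu> assume \<mu>: "\<mu> \<in> {0..<k}"
    show "sawtooth (of_int \<mu> / of_int k) * sawtooth (of_int (h * \<mu>) / of_int k) =
       (of_int \<mu> / of_int k - 1 / 2) * (of_int (?r \<mu>) / of_int k - 1 / 2)
          - (if \<mu> = 0 then 1 / 4 else 0)"
    proof (cases "\<mu> = 0")
      case False
      then have "\<not> k dvd \<mu>" using \<mu> zdvd_not_zless[of \<mu> k] by auto
      moreover from this have "\<not> k dvd h * \<mu>"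
        using assms(2) by (simp add: coprime_dvd_mult_right_iff coprime_commute)
      ultimately show ?thesis
        unfolding sawtooth_of_int_divide[OF assms(1)] using \<mu> False by simp
    qed (simp add: sawtooth_def)
  qed
  also have "\<dots> = (\<Sum>\<mu>\<in>{0..<k}. of_int (\<mu> * ?r \<mu>) / (of_int k)\<^sup>2 - of_int \<mu> / (2 * of_int k)
                       - of_int (?r \<mu>) / (2 * of_int k) + 1 / 4) - 1 / 4"
  proof -
    have "(\<Sum>\<mu>\<in>{0..<k}. if \<mu> = 0 then 1 / 4 else 0 :: real) = 1 / 4"
      using assms(1) by simp
    moreover have "(of_int \<mu> / of_int k - 1 / 2) * (of_int (?r \<mu>) / of_int k - 1 / 2) =
        of_int (\<mu> * ?r \<mu>) / (of_int k)\<^sup>2 - of_int \<mu> / (2 * of_int k)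
          - of_int (?r \<mu>) / (2 * of_int k) + (1 / 4 :: real)" for \<mu>
      using assms(1) by (simp add: power2_eq_square field_simps)
    ultimately show ?thesis by (simp only: sum_subtractf)
  qed
  also have "\<dots> = of_int (\<Sum>\<mu>\<in>{0..<k}. \<mu> * ?r \<mu>) / (of_int k)\<^sup>2
      - of_int (\<Sum>\<mu>\<in>{0..<k}. \<mu>) / (2 * of_int k) - of_int (\<Sum>\<mu>\<in>{0..<k}. ?r \<mu>) / (2 * of_int k)
      + of_int k / 4 - 1 / 4"
    using assms(1) by (simp add: sum_subtractf sum.distrib sum_divide_distrib)
  also have "(\<Sum>\<mu>\<in>{0..<k}. ?r \<mu>) = (\<Sum>\<mu>\<in>{0..<k}. \<mu>)"
    by (rule sum.reindex_bij_betw[OF bij_betw_mult_mod[OF assms]])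
  also have "(\<Sum>\<mu>\<in>{0..<k}. \<mu> * ?r \<mu>) = h * (\<Sum>\<mu>\<in>{0..<k}. \<mu>\<^sup>2) - k * floor_moment h k"
    unfolding floor_moment_def sum_distrib_left sum_subtractf[symmetric]
    by (intro sum.cong refl) (simp add: algebra_simps power2_eq_square flip: minus_mult_div_eq_mod)
  finally have main: "dedekind_sum h k = of_int (h * (\<Sum>\<mu>\<in>{0..<k}. \<mu>\<^sup>2) - k * floor_moment h k) / (of_int k)\<^sup>2
      - of_int (\<Sum>\<mu>\<in>{0..<k}. \<mu>) / (2 * of_int k) - of_int (\<Sum>\<mu>\<in>{0..<k}. \<mu>) / (2 * of_int k)
      + of_int k / 4 - 1 / 4" .
  have "of_int (2 * (\<Sum>\<mu>\<in>{0..<k}. \<mu>)) = (of_int (k * (k - 1)) :: real)"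
       "of_int (6 * (\<Sum>\<mu>\<in>{0..<k}. \<mu>\<^sup>2)) = (of_int ((k - 1) * k * (2 * k - 1)) :: real)"
    using sum_int_lessThan[of k] sum_int_squares_lessThan[of k] assms(1) by simp_all
  then have sums: "of_int (\<Sum>\<mu>\<in>{0..<k}. \<mu>) = (of_int k * (of_int k - 1) / 2 :: real)"
       "of_int (\<Sum>\<mu>\<in>{0..<k}. \<mu>\<^sup>2) = ((of_int k - 1) * of_int k * (2 * of_int k - 1) / 6 :: real)"
    by (simp_all del: of_int_sum)
  show ?thesis
    unfolding dedekind_S_def main of_int_mult of_int_diff sums using assms(1)
    by (simp add: field_simps power2_eq_square)
qed

text \<open>
  With \<open>f = h \<mu> div k\<close>, the number \<open>f (f + 1)\<close> is the sum of \<open>2 \<nu>\<close> over \<open>\<nu> \<le> f\<close>.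
  Exchanging the order of summation counts, for each \<open>\<nu>\<close>, the lattice points to the right of the
  line \<open>h \<mu> = k \<nu>\<close>, on which coprimality leaves no lattice point in the relevant range.
\<close>

lemma sum_floor_pronic:
  assumes "h > 0" "k > 0" "coprime h k"
  shows "(\<Sum>\<mu>\<in>{0..<k}. (h * \<mu> div k) * (h * \<mu> div k + 1)) =
           (k - 1) * h * (h - 1) - 2 * floor_moment k h"
proof -
  let ?f = "\<lambda>\<mu>. h * \<mu> div k" and ?g = "\<lambda>\<nu>. k * \<nu> div h"
  have f: "0 \<le> ?f \<mu>" "?f \<mu> < h" if "\<mu> \<in> {0..<k}" for \<mu>
  proof -
    show "0 \<le> ?f \<mu>" using that assms by (simp add: int_le_div_iff)
    have "\<not> k * h \<le> h * \<mu>" using that assms by (simp add: mult.commute[of k])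
    then show "?f \<mu> < h" using assms by (simp add: int_le_div_iff flip: not_le)
  qed
  have "(\<Sum>\<mu>\<in>{0..<k}. ?f \<mu> * (?f \<mu> + 1)) = (\<Sum>\<mu>\<in>{0..<k}. \<Sum>\<nu>\<in>{0..<h}. if \<nu> \<le> ?f \<mu> then 2 * \<nu> else 0)"
  proof (rule sum.cong[OF refl])
    fix \<mu> assume \<mu>: "\<mu> \<in> {0..<k}"
    have "(\<Sum>\<nu>\<in>{0..<h}. if \<nu> \<le> ?f \<mu> then 2 * \<nu> else 0) = (\<Sum>\<nu>\<in>{0..<?f \<mu> + 1}. 2 * \<nu>)"
      using f[OF \<mu>] by (intro sum.mono_neutral_cong_right) auto
    also have "\<dots> = ?f \<mu> * (?f \<mu> + 1)"
      using sum_int_lessThan[of "?f \<mu> + 1"] f[OF \<mu>] by (simp flip: sum_distrib_left)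
    finally show "?f \<mu> * (?f \<mu> + 1) = (\<Sum>\<nu>\<in>{0..<h}. if \<nu> \<le> ?f \<mu> then 2 * \<nu> else 0)" by simp
  qed
  also have "\<dots> = (\<Sum>\<nu>\<in>{0..<h}. \<Sum>\<mu>\<in>{0..<k}. if \<nu> \<le> ?f \<mu> then 2 * \<nu> else 0)"
    by (rule sum.swap)
  also have "\<dots> = (\<Sum>\<nu>\<in>{0..<h}. 2 * \<nu> * (k - 1 - ?g \<nu>))"
  proof (rule sum.cong[OF refl])
    fix \<nu> assume \<nu>: "\<nu> \<in> {0..<h}"
    show "(\<Sum>\<mu>\<in>{0..<k}. if \<nu> \<le> ?f \<mu> then 2 * \<nu> else 0) = 2 * \<nu> * (k - 1 - ?g \<nu>)"
    proof (cases "\<nu> = 0")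
      case False
      then have "\<not> h dvd \<nu>" using \<nu> zdvd_not_zless[of \<nu> h] by auto
      then have nd: "\<not> h dvd k * \<nu>"
        using assms(3) by (simp add: coprime_dvd_mult_right_iff)
      have iff: "\<nu> \<le> ?f \<mu> \<longleftrightarrow> ?g \<nu> < \<mu>" for \<mu>
      proof -
        have "\<nu> \<le> ?f \<mu> \<longleftrightarrow> k * \<nu> \<le> h * \<mu>"
          using assms(2) by (rule int_le_div_iff)
        also have "\<dots> \<longleftrightarrow> k * \<nu> < h * \<mu>" using nd by (auto simp: order_le_less)
        also have "\<dots> \<longleftrightarrow> ?g \<nu> < \<mu>"
          using assms(1) by (simp add: int_le_div_iff flip: not_le)
        finally show ?thesis .
      qed
      have g: "0 \<le> ?g \<nu>" "?g \<nu> < k"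
      proof -
        show "0 \<le> ?g \<nu>" using \<nu> assms by (simp add: int_le_div_iff)
        have "\<not> h * k \<le> k * \<nu>" using \<nu> assms by (simp add: mult.commute[of h])
        then show "?g \<nu> < k" using assms by (simp add: int_le_div_iff flip: not_le)
      qed
      have "(\<Sum>\<mu>\<in>{0..<k}. if \<nu> \<le> ?f \<mu> then 2 * \<nu> else 0) = (\<Sum>\<mu>\<in>{?g \<nu><..<k}. 2 * \<nu>)"
        using g by (intro sum.mono_neutral_cong_right) (auto simp: iff)
      then show ?thesis using g by simp
    qed (auto intro!: sum.neutral)
  qed
  also have "\<dots> = (k - 1) * (2 * (\<Sum>\<nu>\<in>{0..<h}. \<nu>)) - 2 * floor_moment k h"
    unfolding floor_moment_def sum_distrib_left sum_subtractf[symmetric]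
    by (intro sum.cong refl) (simp add: algebra_simps)
  finally show ?thesis
    using sum_int_lessThan[of h] assms(1) by (simp add: mult.assoc)
qed

text \<open>
  The residues \<open>h \<mu> mod k\<close> are a permutation of \<open>0, \<dots>, k - 1\<close>, so their sum and their sum of
  squares are known. The first determines the sum of the floors; the second relates the sum of
  the squared floors to the moment of \<open>h, k\<close>; and the lattice point count relates it to the
  moment of \<open>k, h\<close>.
\<close>

lemma floor_moment_reciprocity:
  assumes "h > 0" "k > 0" "coprime h k"
  shows "12 * (h * floor_moment h k + k * floor_moment k h) =
           (h - 1) * (k - 1) * (8 * h * k - h - k - 1)"
proof -
  let ?f = "\<lambda>\<mu>. h * \<mu> div k" and ?r = "\<lambda>\<mu>. h * \<mu> mod k"
  define A Q F1 F2 where "A = (\<Sum>\<mu>\<in>{0..<k}. \<mu>)" and "Q = (\<Sum>\<mu>\<in>{0..<k}. \<mu>\<^sup>2)"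
    and "F1 = (\<Sum>\<mu>\<in>{0..<k}. ?f \<mu>)" and "F2 = (\<Sum>\<mu>\<in>{0..<k}. (?f \<mu>)\<^sup>2)"
  have bij: "bij_betw ?r {0..<k} {0..<k}" by (rule bij_betw_mult_mod[OF assms(2,3)])
  have r: "?r \<mu> = h * \<mu> - k * ?f \<mu>" for \<mu> by (simp add: minus_mult_div_eq_mod)
  have A: "2 * A = k * (k - 1)" and Q: "6 * Q = (k - 1) * k * (2 * k - 1)"
    unfolding A_def Q_def using assms(2) sum_int_lessThan[of k] sum_int_squares_lessThan[of k] by simp_all
  have "A = (\<Sum>\<mu>\<in>{0..<k}. ?r \<mu>)" unfolding A_def by (rule sum.reindex_bij_betw[OF bij, symmetric])
  also have "\<dots> = h * A - k * F1"
    unfolding A_def F1_def r by (simp add: sum_subtractf sum_distrib_left)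
  finally have 1: "A = h * A - k * F1" .
  have "k * (2 * F1) = k * ((h - 1) * (k - 1))"
    using 1 A by algebra
  then have F1: "2 * F1 = (h - 1) * (k - 1)" using assms(2) by simp
  have "Q = (\<Sum>\<mu>\<in>{0..<k}. (?r \<mu>)\<^sup>2)" unfolding Q_def by (rule sum.reindex_bij_betw[OF bij, symmetric])
  also have "\<dots> = (\<Sum>\<mu>\<in>{0..<k}. h\<^sup>2 * \<mu>\<^sup>2 - 2 * h * k * (\<mu> * ?f \<mu>) + k\<^sup>2 * (?f \<mu>)\<^sup>2)"
    unfolding r by (intro sum.cong refl) (simp add: power2_eq_square algebra_simps)
  also have "\<dots> = h\<^sup>2 * Q - 2 * h * k * floor_moment h k + k\<^sup>2 * F2"
    unfolding Q_def F2_def floor_moment_def by (simp add: sum_subtractf sum.distrib sum_distrib_left)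
  finally have 2: "Q = h\<^sup>2 * Q - 2 * h * k * floor_moment h k + k\<^sup>2 * F2" .
  have 3: "F2 + F1 = (k - 1) * h * (h - 1) - 2 * floor_moment k h"
    unfolding sum_floor_pronic[OF assms, symmetric] F1_def F2_def
    by (simp add: power2_eq_square distrib_left sum.distrib)
  have "k * (12 * (h * floor_moment h k + k * floor_moment k h)) =
          k * ((h - 1) * (k - 1) * (8 * h * k - h - k - 1))"
    using 2 3 F1 Q by algebra
  then show ?thesis using assms(2) by simp
qed

theorem dedekind_S_reciprocity:
  assumes "h > 0" "k > 0" "coprime h k"
  shows "dedekind_S h k + dedekind_S k h =
           - 3 + of_int h / of_int k + of_int k / of_int h + 1 / (of_int h * of_int k)"
proof -
  define H K P P' where "H = (of_int h :: real)" and "K = (of_int k :: real)"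
    and "P = (of_int (floor_moment h k) :: real)" and "P' = (of_int (floor_moment k h) :: real)"
  have pos: "H > 0" "K > 0" using assms by (simp_all add: H_def K_def)
  have "of_int (12 * (h * floor_moment h k + k * floor_moment k h)) =
          (of_int ((h - 1) * (k - 1) * (8 * h * k - h - k - 1)) :: real)"
    using floor_moment_reciprocity[OF assms] by simp
  then have rec: "12 * (H * P + K * P') = (H - 1) * (K - 1) * (8 * H * K - H - K - 1)"
    by (simp add: H_def K_def P_def P'_def)
  have "dedekind_S h k + dedekind_S k h =
          2 * H * (K - 1) * (2 * K - 1) / K + 2 * K * (H - 1) * (2 * H - 1) / H
          - 12 * (H * P + K * P') / (H * K) - 3 * (K - 1) - 3 * (H - 1)"
    using dedekind_S_eq_floor_moment[of k h] dedekind_S_eq_floor_moment[of h k] assms pos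
    by (simp add: coprime_commute H_def K_def P_def P'_def add_divide_distrib distrib_left)
  also have "\<dots> = - 3 + H / K + K / H + 1 / (H * K)"
    unfolding rec using pos by (simp add: divide_simps) algebra
  finally show ?thesis by (simp add: H_def K_def)
qed

section \<open>Convergents and their Dedekind sums\<close>

text \<open>
  The purely fractional continued fraction \<open>[0, a\<^sub>k\<^sub>+\<^sub>1, a\<^sub>k\<^sub>+\<^sub>2, \<dots>]\<close>.
\<close>

definition cf_tail :: "real \<Rightarrow> nat \<Rightarrow> real" where
  "cf_tail x k = 1 / cf_complete x (Suc k)"

lemma cf_tail_eq_frac: "cf_tail x k = frac (cf_complete x k)"
  by (simp add: cf_tail_def frac_def)

lemma cf_num_simps:
  "cf_num x 0 = cf_coeff x 0"
  "cf_num x (Suc 0) = cf_coeff x 1 * cf_coeff x 0 + 1"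
  "cf_num x (Suc (Suc k)) = cf_coeff x (Suc (Suc k)) * cf_num x (Suc k) + cf_num x k"
  by (simp_all add: cf_num_def numeral_2_eq_2)

lemma cf_den_simps:
  "cf_den x 0 = 1"
  "cf_den x (Suc 0) = cf_coeff x 1"
  "cf_den x (Suc (Suc k)) = cf_coeff x (Suc (Suc k)) * cf_den x (Suc k) + cf_den x k"
  by (simp_all add: cf_den_def numeral_2_eq_2)

lemma convergent_determinant:
  "cf_num x (Suc k) * cf_den x k - cf_num x k * cf_den x (Suc k) = (- 1) ^ k"
proof (induction k)
  case 0
  then show ?case by (simp add: cf_num_simps cf_den_simps algebra_simps)
next
  case (Suc k)
  then show ?case by (simp add: cf_num_simps(3) cf_den_simps(3) algebra_simps)
qed

lemma coprime_consecutive_cf_den: "coprime (cf_den x k) (cf_den x (Suc k))"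
proof (rule coprimeI)
  fix d assume "d dvd cf_den x k" "d dvd cf_den x (Suc k)"
  then have "d dvd (- 1) ^ k"
    unfolding convergent_determinant[of x k, symmetric] by simp
  then show "is_unit d" by (cases "even k") auto
qed

context
  fixes x :: real
  assumes irrational: "x \<notin> \<rat>"
begin

lemma cf_complete_irrational: "cf_complete x k \<notin> \<rat>"
proof (induction k)
  case (Suc k)
  let ?y = "cf_complete x k"
  show ?case
  proof
    assume "cf_complete x (Suc k) \<in> \<rat>"
    then have "1 / cf_complete x (Suc k) + of_int \<lfloor>?y\<rfloor> \<in> \<rat>"
      by (intro Rats_add Rats_divide) auto
    then show False using Suc by simp
  qed
qed (use irrational in simp)

lemma cf_tail_bounds: "0 < cf_tail x k" "cf_tail x k < 1"
proof -
  have "cf_complete x k \<notin> \<int>" using cf_complete_irrational[of k] Ints_subset_Rats by blast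
  then show "0 < cf_tail x k" unfolding cf_tail_eq_frac by (simp add: frac_gt_0_iff)
  show "cf_tail x k < 1" unfolding cf_tail_eq_frac by (rule frac_lt_1)
qed

lemma cf_tail_rec: "cf_tail x k * (of_int (cf_coeff x (Suc k)) + cf_tail x (Suc k)) = 1"
proof -
  have "of_int (cf_coeff x (Suc k)) + cf_tail x (Suc k) = cf_complete x (Suc k)"
    unfolding cf_tail_eq_frac cf_coeff_def by (simp add: frac_def)
  then show ?thesis using cf_tail_bounds(1)[of k] by (simp add: cf_tail_def)
qed

lemma cf_coeff_Suc_ge_1: "cf_coeff x (Suc k) \<ge> 1"
proof -
  have "1 < cf_complete x (Suc k)"
    using cf_tail_bounds[of k] unfolding cf_tail_def by (simp add: divide_simps split: if_splits)
  then show ?thesis unfolding cf_coeff_def by linarith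
qed

lemma cf_den_ge: "cf_den x k \<ge> int k" "cf_den x k \<ge> 1"
proof -
  have "cf_den x k \<ge> int k \<and> cf_den x k \<ge> 1 \<and> cf_den x (Suc k) \<ge> int (Suc k)"
  proof (induction k)
    case 0
    then show ?case using cf_coeff_Suc_ge_1[of 0] by (simp add: cf_den_simps)
  next
    case (Suc k)
    have "1 * cf_den x (Suc k) \<le> cf_coeff x (Suc (Suc k)) * cf_den x (Suc k)"
      using Suc cf_coeff_Suc_ge_1[of "Suc k"] by (intro mult_right_mono) auto
    then have "cf_den x (Suc (Suc k)) \<ge> cf_den x (Suc k) + cf_den x k"
      unfolding cf_den_simps(3) by linarith
    then show ?case using Suc by simp
  qed
  then show "cf_den x k \<ge> int k" "cf_den x k \<ge> 1" by simp_all
qed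

lemma cf_den_less_Suc: "k \<ge> 1 \<Longrightarrow> cf_den x k < cf_den x (Suc k)"
proof -
  assume "k \<ge> 1"
  then obtain j where j: "k = Suc j" by (cases k) auto
  have "1 * cf_den x (Suc j) \<le> cf_coeff x (Suc (Suc j)) * cf_den x (Suc j)"
    using cf_den_ge[of "Suc j"] cf_coeff_Suc_ge_1[of "Suc j"] by (intro mult_right_mono) auto
  then show ?thesis using cf_den_ge(2)[of j] by (simp add: j cf_den_simps(3))
qed

lemma cf_den_less: "1 \<le> k \<Longrightarrow> k < l \<Longrightarrow> cf_den x k < cf_den x l"
proof (induction l)
  case (Suc l)
  then show ?case
    using cf_den_less_Suc[of l] by (cases "k = l") fastforce+
qed simp

text \<open>
  The usual expression of \<open>x\<close> through a complete quotient and two consecutive convergents, solved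
  for the tail: each tail is a Moebius transform of \<open>x\<close>.
\<close>

lemma cf_tail_moebius:
  "cf_tail x (Suc k) * (of_int (cf_num x k) - x * of_int (cf_den x k)) =
     x * of_int (cf_den x (Suc k)) - of_int (cf_num x (Suc k))"
proof (induction k)
  case 0
  have "cf_tail x 0 = x - of_int (cf_coeff x 0)"
    unfolding cf_tail_eq_frac cf_coeff_def by (simp add: frac_def)
  moreover have "cf_tail x 0 * (of_int (cf_coeff x 1) + cf_tail x (Suc 0)) = 1"
    using cf_tail_rec[of 0] by simp
  ultimately show ?case
    unfolding cf_num_simps(1,2) cf_den_simps(1,2) of_int_add of_int_mult of_int_1 by algebra
next
  case (Suc k)
  have "cf_tail x (Suc (Suc k)) * (of_int (cf_num x (Suc k)) - x * of_int (cf_den x (Suc k))) =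
    - (cf_tail x (Suc k) * cf_tail x (Suc (Suc k))) * (of_int (cf_num x k) - x * of_int (cf_den x k))"
    using Suc by algebra
  also have "cf_tail x (Suc k) * cf_tail x (Suc (Suc k)) =
               1 - of_int (cf_coeff x (Suc (Suc k))) * cf_tail x (Suc k)"
    using cf_tail_rec[of "Suc k"] by (simp add: algebra_simps)
  finally show ?case
    using Suc unfolding cf_num_simps(3) cf_den_simps(3) of_int_add of_int_mult by algebra
qed

lemma convergent_error_le:
  "\<bar>of_int (cf_num x k) / of_int (cf_den x k) - x\<bar> \<le> 1 / of_int (cf_den x k)"
proof -
  let ?s = "of_int (cf_num x k) :: real" and ?t = "of_int (cf_den x k) :: real"
  let ?s' = "of_int (cf_num x (Suc k)) :: real" and ?t' = "of_int (cf_den x (Suc k)) :: real"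
  let ?\<xi> = "cf_tail x (Suc k)"
  have t: "?t \<ge> 1" "?t' \<ge> 1" using cf_den_ge(2)[of k] cf_den_ge(2)[of "Suc k"] by simp_all
  define e where "e = (- 1 :: real) ^ k"
  have "of_int (cf_num x (Suc k) * cf_den x k - cf_num x k * cf_den x (Suc k)) = e"
    unfolding convergent_determinant e_def by simp
  moreover have "(?s - x * ?t) * (?t' + ?\<xi> * ?t) = (?s - x * ?t) * ?t' + ?t * (?\<xi> * (?s - x * ?t))"
    by (simp add: algebra_simps)
  ultimately have "(?s - x * ?t) * (?t' + ?\<xi> * ?t) = - e"
    unfolding cf_tail_moebius[of k] by (simp add: algebra_simps)
  then have "\<bar>?s - x * ?t\<bar> * \<bar>?t' + ?\<xi> * ?t\<bar> = 1"
    by (simp add: e_def flip: abs_mult)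
  moreover have "1 \<le> \<bar>?t' + ?\<xi> * ?t\<bar>"
    using t cf_tail_bounds(1)[of "Suc k"] by (simp add: add_increasing2)
  ultimately have "\<bar>?s - x * ?t\<bar> \<le> 1"
    by (metis abs_ge_zero mult_left_mono mult.right_neutral)
  moreover have "?s / ?t - x = (?s - x * ?t) / ?t" using t by (simp add: field_simps)
  ultimately show ?thesis using t by (simp add: abs_divide divide_right_mono)
qed

lemma convergents_tendsto: "(\<lambda>k. of_int (cf_num x k) / of_int (cf_den x k)) \<longlonglongrightarrow> x"
proof (rule LIM_zero_cancel, rule Lim_null_comparison)
  show "\<forall>\<^sub>F k in sequentially. norm (of_int (cf_num x k) / of_int (cf_den x k) - x) \<le> inverse (real k)"
    unfolding eventually_sequentially
  proof (intro exI[of _ 1] allI impI)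
    fix k :: nat assume k: "k \<ge> 1"
    have "real k \<le> of_int (cf_den x k)" using cf_den_ge(1)[of k] by linarith
    then have "1 / of_int (cf_den x k) \<le> inverse (real k)"
      using k by (simp add: inverse_eq_divide frac_le)
    then show "norm (of_int (cf_num x k) / of_int (cf_den x k) - x) \<le> inverse (real k)"
      using convergent_error_le[of k] by simp
  qed
qed (rule lim_inverse_n)

text \<open>
  Since \<open>t\<^sub>k\<^sub>+\<^sub>2\<close> is congruent to \<open>t\<^sub>k\<close> modulo \<open>t\<^sub>k\<^sub>+\<^sub>1\<close>, the reciprocity law turns the Euclidean
  algorithm on the denominators into a recursion with alternating sign. Its term
  \<open>1/(t\<^sub>k\<^sub>+\<^sub>1 t\<^sub>k\<^sub>+\<^sub>2)\<close> is, up to sign, the difference of consecutive convergents and telescopes.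
\<close>

lemma dedekind_S_consecutive_cf_den:
  "dedekind_S (cf_den x k) (cf_den x (Suc k)) =
     (- 1) ^ k * ((\<Sum>j\<le>k. (- 1) ^ j * (of_int (cf_coeff x (Suc j)) - 3))
        + of_int (cf_num x (Suc k)) / of_int (cf_den x (Suc k)) - of_int (cf_coeff x 0))
     + of_int (cf_den x k) / of_int (cf_den x (Suc k))"
proof (induction k)
  case 0
  have "cf_coeff x 1 \<ge> 1" using cf_coeff_Suc_ge_1[of 0] by simp
  moreover have "dedekind_S m 1 = 0" for m
    by (simp add: dedekind_S_def dedekind_sum_def sawtooth_def)
  ultimately show ?case
    using dedekind_S_reciprocity[of 1 "cf_coeff x 1"]
    by (simp add: cf_num_simps cf_den_simps field_simps)
next
  case (Suc k)
  let ?a = "cf_coeff x (Suc (Suc k))"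
  let ?t = "cf_den x k" and ?t' = "cf_den x (Suc k)" and ?t'' = "cf_den x (Suc (Suc k))"
  let ?s = "cf_num x k" and ?s' = "cf_num x (Suc k)" and ?s'' = "cf_num x (Suc (Suc k))"
  have t: "?t \<ge> 1" "?t' \<ge> 1" "?t'' \<ge> 1" by (rule cf_den_ge)+
  have "dedekind_S ?t'' ?t' = dedekind_S ?t ?t'"
    unfolding dedekind_S_def using t
    by (subst dedekind_sum_cong[of _ _ ?t]) (simp_all add: cf_den_simps(3))
  then have "dedekind_S ?t' ?t'' = - 3 + of_int ?t' / of_int ?t'' + of_int ?t'' / of_int ?t'
                + 1 / (of_int ?t' * of_int ?t'') - dedekind_S ?t ?t'"
    using dedekind_S_reciprocity[of ?t' ?t''] t coprime_consecutive_cf_den[of x "Suc k"] by simp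
  also have "of_int ?t'' / of_int ?t' = of_int ?a + (of_int ?t / of_int ?t' :: real)"
    using t unfolding cf_den_simps(3) by (simp add: field_simps)
  also have "1 / (of_int ?t' * of_int ?t'') =
               (- 1) ^ Suc k * (of_int ?s'' / of_int ?t'' - of_int ?s' / of_int ?t' :: real)"
  proof -
    have "of_int (?s'' * ?t' - ?s' * ?t'') = ((- 1) ^ Suc k :: real)"
      unfolding convergent_determinant by simp
    then have "of_int ?s'' / of_int ?t'' - of_int ?s' / of_int ?t' =
        ((- 1) ^ Suc k :: real) / (of_int ?t' * of_int ?t'')"
      using t by (simp add: diff_frac_eq mult.commute)
    then show ?thesis by (simp flip: power_mult_distrib)
  qed
  finally show ?case
    unfolding Suc by (simp add: algebra_simps)
qed

text \<open>
  By the determinant identity, \<open>s\<^sub>k\<^sub>+\<^sub>1\<close> is up to sign the inverse of \<open>t\<^sub>k\<close> modulo \<open>t\<^sub>k\<^sub>+\<^sub>1\<close>, so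
  the Dedekind sums of \<open>s\<^sub>k\<^sub>+\<^sub>1/t\<^sub>k\<^sub>+\<^sub>1\<close> and \<open>t\<^sub>k/t\<^sub>k\<^sub>+\<^sub>1\<close> agree up to that sign.
\<close>

theorem barkan_hickerson_knuth:
  "dedekind_S (cf_num x (Suc k)) (cf_den x (Suc k)) =
     (\<Sum>j\<le>k. (- 1) ^ j * (of_int (cf_coeff x (Suc j)) - 3))
     + of_int (cf_num x (Suc k)) / of_int (cf_den x (Suc k)) - of_int (cf_coeff x 0)
     + (- 1) ^ k * of_int (cf_den x k) / of_int (cf_den x (Suc k))"
proof -
  let ?t = "cf_den x k" and ?t' = "cf_den x (Suc k)" and ?s' = "cf_num x (Suc k)"
  have "dedekind_sum ?s' ?t' = of_int ((- 1) ^ k) * dedekind_sum ?t ?t'"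
  proof (rule dedekind_sum_inverse)
    show "?t' > 0" using cf_den_ge(2)[of "Suc k"] by simp
    show "(- 1) ^ k = (1::int) \<or> (- 1) ^ k = (- 1 :: int)" by (cases "even k") auto
    have "?s' * ?t = (- 1) ^ k + cf_num x k * ?t'"
      using convergent_determinant[of x k] by simp
    then show "?s' * ?t mod ?t' = (- 1) ^ k mod ?t'" by simp
  qed
  then have "dedekind_S ?s' ?t' = (- 1) ^ k * dedekind_S ?t ?t'" by (simp add: dedekind_S_def)
  then show ?thesis
    unfolding dedekind_S_consecutive_cf_den
    by (simp add: distrib_left flip: mult.assoc power_mult_distrib)
qed

end

section \<open>Continuants as matrix products\<close>

text \<open>
  A 2 by 2 matrix, listed row by row.
\<close>

type_synonym mat2 = "int \<times> int \<times> int \<times> int"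

fun mat2_mult :: "mat2 \<Rightarrow> mat2 \<Rightarrow> mat2" where
  "mat2_mult (a, b, c, d) (a', b', c', d') =
     (a * a' + b * c', a * b' + b * d', c * a' + d * c', c * b' + d * d')"

fun mat2_transpose :: "mat2 \<Rightarrow> mat2" where
  "mat2_transpose (a, b, c, d) = (a, c, b, d)"

fun mat2_det :: "mat2 \<Rightarrow> int" where
  "mat2_det (a, b, c, d) = a * d - b * c"

lemma mat2_mult_assoc: "mat2_mult (mat2_mult M N) P = mat2_mult M (mat2_mult N P)"
  by (cases M; cases N; cases P) (simp add: algebra_simps)

lemma mat2_mult_1: "mat2_mult (1, 0, 0, 1) M = M" "mat2_mult M (1, 0, 0, 1) = M"
  by (cases M; simp)+

lemma mat2_transpose_mult:
  "mat2_transpose (mat2_mult M N) = mat2_mult (mat2_transpose N) (mat2_transpose M)"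
  by (cases M; cases N) (simp add: algebra_simps)

lemma mat2_det_mult: "mat2_det (mat2_mult M N) = mat2_det M * mat2_det N"
  by (cases M; cases N) (simp add: algebra_simps)

text \<open>
  The entries are the continuants of the word: the first column holds the numerator and the
  denominator of the continued fraction, the second those without the last letter. Concatenation
  of words becomes multiplication, and reversal becomes transposition.
\<close>

primrec cf_mat :: "int list \<Rightarrow> mat2" where
  "cf_mat [] = (1, 0, 0, 1)"
| "cf_mat (a # l) = mat2_mult (a, 1, 1, 0) (cf_mat l)"

lemma cf_mat_append: "cf_mat (l @ l') = mat2_mult (cf_mat l) (cf_mat l')"
  by (induction l) (simp_all add: mat2_mult_1 mat2_mult_assoc del: mat2_mult.simps)

lemma cf_mat_rev: "cf_mat (rev l) = mat2_transpose (cf_mat l)"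
  by (induction l) (simp_all add: cf_mat_append mat2_mult_1 mat2_transpose_mult del: mat2_mult.simps)

lemma cf_mat_det: "mat2_det (cf_mat l) = (- 1) ^ length l"
  by (induction l) (simp_all add: mat2_det_mult del: mat2_mult.simps)

lemma cf_mat_pos:
  assumes "\<forall>a\<in>set l. a \<ge> 1" "cf_mat l = (A, B, C, D)"
  shows "A \<ge> 1 \<and> B \<ge> 0 \<and> C \<ge> 0 \<and> D \<ge> 0 \<and> B + D \<ge> 1"
  using assms
proof (induction l arbitrary: A B C D)
  case (Cons a l)
  obtain A' B' C' D' where l: "cf_mat l = (A', B', C', D')" by (cases "cf_mat l")
  have IH: "A' \<ge> 1" "B' \<ge> 0" "C' \<ge> 0" "D' \<ge> 0" "B' + D' \<ge> 1"
    using Cons.IH[OF _ l] Cons.prems by auto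
  have "a \<ge> 1" using Cons.prems by simp
  then have "1 * A' \<le> a * A'" "1 * B' \<le> a * B'" using IH by (intro mult_right_mono; simp)+
  moreover have "A = a * A' + C'" "B = a * B' + D'" "C = A'" "D = B'"
    using Cons.prems(2) l by auto
  ultimately show ?case using IH by linarith
qed auto

lemma cf_mat_snd_pos:
  assumes "\<forall>a\<in>set l. a \<ge> 1" "l \<noteq> []" "cf_mat l = (A, B, C, D)"
  shows "B \<ge> 1"
proof -
  obtain a l' where l: "l = a # l'" using assms(2) by (cases l) auto
  obtain A' B' C' D' where l': "cf_mat l' = (A', B', C', D')" by (cases "cf_mat l'")
  have "B' \<ge> 0" "B' + D' \<ge> 1" using cf_mat_pos[OF _ l'] assms(1) l by auto
  moreover have "1 * B' \<le> a * B'" using assms(1) l \<open>B' \<ge> 0\<close> by (intro mult_right_mono) auto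
  ultimately show ?thesis using assms(3) l l' by auto
qed

text \<open>
  The continued fraction whose partial quotients are the given word, continued by the complete
  quotient \<open>z\<close>.
\<close>

primrec cf_eval :: "int list \<Rightarrow> real \<Rightarrow> real" where
  "cf_eval [] z = z"
| "cf_eval (a # l) z = of_int a + 1 / cf_eval l z"

lemma cf_eval_append: "cf_eval (l @ l') z = cf_eval l (cf_eval l' z)"
  by (induction l) simp_all

lemma cf_eval_moebius:
  assumes "\<forall>a\<in>set l. a \<ge> 1" "z > 0" "cf_mat l = (A, B, C, D)"
  shows "of_int A * z + of_int B > 0 \<and> of_int C * z + of_int D > 0 \<and>
         cf_eval l z = (of_int A * z + of_int B) / (of_int C * z + of_int D)"
  using assms
proof (induction l arbitrary: A B C D)
  case (Cons a l)
  obtain A' B' C' D' where l: "cf_mat l = (A', B', C', D')" by (cases "cf_mat l")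
  have IH: "of_int A' * z + of_int B' > 0" "of_int C' * z + of_int D' > 0"
    "cf_eval l z = (of_int A' * z + of_int B') / (of_int C' * z + of_int D')"
    using Cons.IH[OF _ _ l] Cons.prems by auto
  have eqs: "A = a * A' + C'" "B = a * B' + D'" "C = A'" "D = B'" using Cons.prems(3) l by auto
  have numer: "of_int A * z + of_int B = of_int a * (of_int A' * z + of_int B') + (of_int C' * z + of_int D')"
    by (simp add: eqs algebra_simps)
  have "of_int a * (of_int A' * z + of_int B') > 0" using IH(1) Cons.prems(1) by simp
  then have "of_int A * z + of_int B > 0" unfolding numer using IH(2) by linarith
  moreover have "cf_eval (a # l) z = of_int a + (of_int C' * z + of_int D') / (of_int A' * z + of_int B')"
    by (simp only: cf_eval.simps IH(3)) simp
  then have "cf_eval (a # l) z = (of_int A * z + of_int B) / (of_int A' * z + of_int B')"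
    unfolding numer using IH(1) by (subst add_divide_distrib) simp
  ultimately show ?case using IH(1) unfolding eqs(3,4) by blast
qed auto

lemma cf_eval_gt_1: "\<forall>a\<in>set l. a \<ge> 1 \<Longrightarrow> z > 1 \<Longrightarrow> cf_eval l z > 1"
proof (induction l)
  case (Cons a l)
  then have "1 / cf_eval l z > 0" "real_of_int a \<ge> 1" by auto
  then show ?case by (simp only: cf_eval.simps)
qed simp

lemma cf_complete_Suc_shift: "cf_complete x (Suc k) = cf_complete (1 / (x - of_int \<lfloor>x\<rfloor>)) k"
  by (induction k) simp_all

text \<open>
  Uniqueness of the expansion: a representation with positive integers and a final complete quotient
  greater than 1 exhibits the regular continued fraction. The first letter is unrestricted.
\<close>

lemma cf_coeff_cf_eval:
  assumes "\<forall>a\<in>set l. a \<ge> 1" "z > 1" "j \<le> length l"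
  shows "cf_coeff (cf_eval (a # l) z) j = (a # l) ! j"
  using assms
proof (induction j arbitrary: a l)
  case 0
  then show ?case using cf_eval_gt_1[of l z] by (simp add: cf_coeff_def floor_eq_iff)
next
  case (Suc j)
  have gt: "cf_eval l z > 1" using Suc.prems cf_eval_gt_1[of l z] by simp
  then have "\<lfloor>cf_eval (a # l) z\<rfloor> = a" by (simp add: floor_eq_iff)
  then have "cf_coeff (cf_eval (a # l) z) (Suc j) = cf_coeff (cf_eval l z) j"
    unfolding cf_coeff_def cf_complete_Suc_shift using gt by simp
  moreover obtain a' l' where l: "l = a' # l'" using Suc.prems by (cases l) auto
  ultimately show ?case using Suc.IH[of l' a'] Suc.prems by simp
qed

section \<open>The folded continued fraction of the lacunary series\<close>

text \<open>
  With \<open>b - 1\<close> added at both ends, \<open>fold_word b n\<close> is the continued fraction word of the reciprocal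
  of the partial sum with denominator \<open>b ^ 2 ^ (n + 2)\<close>. Stripping the end letters makes the folding
  rule uniform. The recursion starts at the partial sum with three terms, the first one whose word
  both begins and ends with \<open>b - 1\<close>.
\<close>

primrec fold_word :: "int \<Rightarrow> nat \<Rightarrow> int list" where
  "fold_word b 0 = [b + 2, b]"
| "fold_word b (Suc n) = fold_word b n @ [b, b - 2] @ rev (fold_word b n)"

lemma length_fold_word: "length (fold_word b n) + 2 = 2 ^ (n + 2)"
  by (induction n) simp_all

lemma fold_word_ge_1: "b \<ge> 3 \<Longrightarrow> \<forall>a\<in>set (fold_word b n). a \<ge> 1"
  by (induction n) auto

lemma cf_mat_snoc:
  assumes "cf_mat u = (A, B, C, D)"
  shows "cf_mat (u @ [a]) = (a * A + B, A, a * C + D, C)"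
  using assms by (simp add: cf_mat_append mult.commute)

text \<open>
  The folding lemma: if the word of \<open>t/s\<close> has even length, then splitting its last letter \<open>a\<close>
  into \<open>a + 1, a - 1\<close> and continuing with the mirror image gives the word of the reciprocal of
  \<open>s/t + 1/t\<^sup>2\<close>. The long word is a product of a matrix and a transposed matrix, whose first
  column is evaluated with the determinant 1.
\<close>

lemma cf_mat_folding:
  assumes "cf_mat (u @ [a]) = (t, t', s, s')" "odd (length u)"
  shows "\<exists>p q. cf_mat (u @ [a + 1, a - 1] @ rev u) = (t\<^sup>2, p, s * t + 1, q)"
proof -
  obtain A B C D where u: "cf_mat u = (A, B, C, D)" by (cases "cf_mat u")
  have eqs: "t = a * A + B" "t' = A" "s = a * C + D" "s' = C"
    using assms(1) cf_mat_snoc[OF u, of a] by auto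
  have "mat2_det (cf_mat (u @ [a])) = 1" using assms(2) by (simp add: cf_mat_det)
  then have det: "t * s' - t' * s = 1" by (simp add: assms(1))
  have "u @ [a + 1, a - 1] @ rev u = (u @ [a + 1]) @ rev (u @ [a - 1])" by simp
  then have "cf_mat (u @ [a + 1, a - 1] @ rev u) =
      mat2_mult (cf_mat (u @ [a + 1])) (mat2_transpose (cf_mat (u @ [a - 1])))"
    by (simp only: cf_mat_append[of "u @ [a + 1]"] cf_mat_rev)
  also have "cf_mat (u @ [a + 1]) = (t + t', t', s + s', s')"
    unfolding cf_mat_snoc[OF u] eqs by (simp add: algebra_simps)
  also have "cf_mat (u @ [a - 1]) = (t - t', t', s - s', s')"
    unfolding cf_mat_snoc[OF u] eqs by (simp add: algebra_simps)
  finally have "cf_mat (u @ [a + 1, a - 1] @ rev u) =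
      ((t + t') * (t - t') + t' * t', (t + t') * (s - s') + t' * s',
       (s + s') * (t - t') + s' * t', (s + s') * (s - s') + s' * s')" by simp
  moreover have "(t + t') * (t - t') + t' * t' = t\<^sup>2" by (simp add: algebra_simps power2_eq_square)
  moreover have "(s + s') * (t - t') + s' * t' = s * t + 1" using det by algebra
  ultimately show ?thesis by simp
qed

lemma cf_mat_fold_word:
  assumes "b \<ge> 2"
  shows "\<exists>t' s s'. cf_mat ((int b - 1) # fold_word (int b) n @ [int b - 1]) =
             (int b ^ 2 ^ (n + 2), t', s, s') \<and>
           of_int s / real b ^ 2 ^ (n + 2) = (\<Sum>j\<le>n + 2. (1 / real b) ^ 2 ^ j)"
proof (induction n)
  case 0
  let ?b = "int b"
  obtain T t' s s' where mat: "cf_mat ((?b - 1) # fold_word ?b 0 @ [?b - 1]) = (T, t', s, s')"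
    by (cases "cf_mat ((?b - 1) # fold_word ?b 0 @ [?b - 1])")
  then have Ts: "T = ?b ^ 2 ^ (0 + 2)" "s = ?b ^ 3 + ?b ^ 2 + 1"
    by (auto simp: algebra_simps power2_eq_square power3_eq_cube power4_eq_xxxx)
  have "{..0 + 2} = {0, 1, 2 :: nat}" by auto
  then have "of_int (?b ^ 3 + ?b ^ 2 + 1) / real b ^ 2 ^ (0 + 2) = (\<Sum>j\<le>0 + 2. (1 / real b) ^ 2 ^ j)"
    using assms by (simp add: field_simps power2_eq_square power3_eq_cube power4_eq_xxxx)
  then show ?case using mat unfolding Ts by blast
next
  case (Suc n)
  let ?b = "int b"
  let ?u = "(?b - 1) # fold_word ?b n"
  obtain t' s s' where IH: "cf_mat (?u @ [?b - 1]) = (?b ^ 2 ^ (n + 2), t', s, s')"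
    "of_int s / real b ^ 2 ^ (n + 2) = (\<Sum>j\<le>n + 2. (1 / real b) ^ 2 ^ j)"
    using Suc.IH by auto
  have "even (length (fold_word ?b n) + 2)" unfolding length_fold_word by simp
  then have "odd (length ?u)" by simp
  from cf_mat_folding[OF IH(1) this] obtain p q where
    pq: "cf_mat (?u @ [?b - 1 + 1, ?b - 1 - 1] @ rev ?u) = ((?b ^ 2 ^ (n + 2))\<^sup>2, p, s * ?b ^ 2 ^ (n + 2) + 1, q)"
    by blast
  have "(?b ^ 2 ^ (n + 2))\<^sup>2 = ?b ^ 2 ^ (Suc n + 2)" by (simp flip: power_mult add: mult.commute)
  moreover have "?u @ [?b - 1 + 1, ?b - 1 - 1] @ rev ?u = (?b - 1) # fold_word ?b (Suc n) @ [?b - 1]"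
    by simp
  moreover have "of_int (s * ?b ^ 2 ^ (n + 2) + 1) / real b ^ 2 ^ (Suc n + 2) =
      (\<Sum>j\<le>Suc n + 2. (1 / real b) ^ 2 ^ j)"
  proof -
    have "real b ^ 2 ^ (Suc n + 2) = real b ^ 2 ^ (n + 2) * real b ^ 2 ^ (n + 2)"
      by (simp flip: power_add)
    then have "of_int (s * ?b ^ 2 ^ (n + 2) + 1) / real b ^ 2 ^ (Suc n + 2) =
        of_int s / real b ^ 2 ^ (n + 2) + 1 / real b ^ 2 ^ (Suc n + 2)"
      using assms by (simp add: add_divide_distrib)
    then show ?thesis unfolding IH(2) by (simp add: power_divide)
  qed
  ultimately show ?case using pq by metis
qed

text \<open>
  Solving the Moebius relation for the complete quotient \<open>z\<close> that follows the word of the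
  partial sum gives \<open>z = 1/(q\<^sup>2 d) - t'/q\<close>, where \<open>d\<close> is the remaining tail of the series. As
  \<open>q\<^sup>2 d\<close> is only slightly larger than 1, this \<open>z\<close> lies strictly between \<open>1/2\<close> and 1: it is
  not an admissible complete quotient, but \<open>b - 1 + 1/z = b + 1/z'\<close> with \<open>z' = z/(1 - z) > 1\<close>.
  So the last letter of the true expansion is \<open>b\<close> instead of \<open>b - 1\<close>.
\<close>

lemma x_series_eq_cf_eval:
  assumes "b \<ge> 3"
  shows "\<exists>z>1. x_series b = cf_eval (0 # (int b - 1) # fold_word (int b) n @ [int b]) z"
proof -
  let ?b = "int b"
  let ?u = "(?b - 1) # fold_word ?b n"
  define x q y where "x = x_series b" and "q = real b ^ 2 ^ (n + 2)" and "y = 1 / q\<^sup>2"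
  obtain t' s s' where mat: "cf_mat (?u @ [?b - 1]) = (?b ^ 2 ^ (n + 2), t', s, s')"
    and s: "of_int s / q = (\<Sum>j\<le>n + 2. (1 / real b) ^ 2 ^ j)"
    using cf_mat_fold_word[of b n] assms unfolding q_def append_Cons by auto
  define T' S S' where "T' = real_of_int t'" and "S = real_of_int s" and "S' = real_of_int s'"
  have u_ge_1: "\<forall>a\<in>set ?u. a \<ge> 1" using fold_word_ge_1[of ?b n] assms by auto
  have q: "q \<ge> 3"
  proof -
    have "real b ^ 1 \<le> real b ^ 2 ^ (n + 2)"
      using assms by (intro power_increasing) simp_all
    then have "real b \<le> q" by (simp only: q_def power_one_right)
    moreover have "3 \<le> real b" using assms by simp
    ultimately show ?thesis by linarith
  qed
  have det: "q * S' - T' * S = 1"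
  proof -
    have "even (length (fold_word ?b n) + 2)" unfolding length_fold_word by simp
    then have "mat2_det (cf_mat (?u @ [?b - 1])) = 1" unfolding cf_mat_det by simp
    then have "?b ^ 2 ^ (n + 2) * s' - t' * s = 1" unfolding mat by simp
    then have "real_of_int (?b ^ 2 ^ (n + 2) * s' - t' * s) = 1" by (simp only: of_int_1)
    then show ?thesis by (simp add: q_def T'_def S_def S'_def)
  qed
  have T': "0 < T'" "2 * T' + 1 \<le> q"
  proof -
    obtain A B C D where u: "cf_mat ?u = (A, B, C, D)" by (cases "cf_mat ?u")
    have "A \<ge> 1" "B \<ge> 1" using cf_mat_pos[OF u_ge_1 u] cf_mat_snd_pos[OF u_ge_1 _ u] by auto
    moreover have "?b ^ 2 ^ (n + 2) = (?b - 1) * A + B" "t' = A"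
      using mat cf_mat_snoc[OF u, of "?b - 1"] by simp_all
    moreover have "2 * A \<le> (?b - 1) * A" using assms \<open>A \<ge> 1\<close> by (intro mult_right_mono) auto
    ultimately have "0 < t'" "2 * t' + 1 \<le> ?b ^ 2 ^ (n + 2)" by linarith+
    then have "0 < real_of_int t'" "real_of_int (2 * t' + 1) \<le> real_of_int (?b ^ 2 ^ (n + 2))"
      by (simp_all only: of_int_0_less_iff of_int_le_iff)
    then show "0 < T'" "2 * T' + 1 \<le> q" by (simp_all add: T'_def q_def)
  qed
  define d where "d = x - S / q"
  have y: "0 < y" "y < 1"
  proof -
    have "1 < q\<^sup>2" using q by (simp add: one_less_power)
    moreover from this have "0 < q\<^sup>2" by linarith
    ultimately show "0 < y" "y < 1" unfolding y_def by (simp_all only: zero_less_divide_1_iff divide_less_eq_1_pos)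
  qed
  have d: "y < d" "d \<le> y / (1 - y)"
  proof -
    have "x = (\<Sum>j. (1 / real b) ^ 2 ^ (j + (n + 3))) + (\<Sum>j<n + 3. (1 / real b) ^ 2 ^ j)"
      unfolding x_def x_series_altdef using assms
      by (intro suminf_split_initial_segment power2_series(1)) auto
    moreover have "{..<n + 3} = {..n + 2}" by auto
    moreover have "(1 / real b) ^ 2 ^ (j + (n + 3)) = y ^ 2 ^ j" for j
    proof -
      have "(2::nat) ^ (n + 3) = 2 ^ (n + 2) * 2" by (simp add: power_add)
      then have "y = (1 / real b) ^ 2 ^ (n + 3)"
        by (simp only: y_def q_def power_divide power_one power_mult)
      then show ?thesis by (simp only: power_mult [symmetric] power_add mult_ac)
    qed
    ultimately have "d = (\<Sum>j. y ^ 2 ^ j)" using s by (simp add: d_def S_def)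
    then show "y < d" "d \<le> y / (1 - y)" using power2_series(2,3)[OF y] by simp_all
  qed
  have d_pos: "d > 0" using d y by linarith
  define z where "z = 1 / (q\<^sup>2 * d) - T' / q"
  have z1: "z < 1"
  proof -
    have "1 < q\<^sup>2 * d" using d(1) q by (simp add: y_def field_simps)
    then have "1 / (q\<^sup>2 * d) < 1" by simp
    moreover have "T' / q > 0" using T' q by simp
    ultimately show ?thesis by (simp add: z_def)
  qed
  have z2: "1 / 2 < z"
  proof -
    have "d * (1 - y) \<le> y" using d(2) y by (simp add: pos_le_divide_eq)
    then have "(1 - y) * (q\<^sup>2 * d) \<le> y * q\<^sup>2"
      using q mult_right_mono[of "d * (1 - y)" y "q\<^sup>2"] by (simp add: mult_ac)
    also have "y * q\<^sup>2 = 1" using q by (simp add: y_def)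
    finally have "1 - y \<le> 1 / (q\<^sup>2 * d)" using d_pos q by (simp add: pos_le_divide_eq)
    moreover have "T' / q \<le> 1 / 2 - 1 / (2 * q)" using T'(2) q by (simp add: field_simps)
    moreover have "y < 1 / (2 * q)" using q by (simp add: y_def power2_eq_square divide_simps)
    ultimately show ?thesis unfolding z_def by linarith
  qed
  have "cf_eval (?u @ [?b - 1]) z = 1 / x"
  proof -
    have "\<forall>a\<in>set (?u @ [?b - 1]). a \<ge> 1" using u_ge_1 assms by auto
    from cf_eval_moebius[OF this _ mat, of z] z2
    have den: "S * z + S' > 0" "q * z + T' > 0"
      and eval: "cf_eval (?u @ [?b - 1]) z = (q * z + T') / (S * z + S')"
      by (simp_all add: q_def T'_def S_def S'_def)
    have "q * d = x * q - S" using q by (simp add: d_def field_simps)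
    have "z * (x * q - S) = (1 / (q\<^sup>2 * d) - T' / q) * (q * d)"
      using \<open>q * d = x * q - S\<close> by (simp add: z_def)
    also have "\<dots> = 1 / q - T' * d" using q d_pos by (simp add: field_simps power2_eq_square)
    also have "\<dots> = (q * S' - T' * S) / q - T' * d" by (simp add: det)
    also have "\<dots> = S' - x * T'" using q by (simp add: d_def field_simps)
    finally have "x * (q * z + T') = S * z + S'" by (simp add: algebra_simps)
    moreover from this have "x \<noteq> 0" using den by auto
    ultimately show ?thesis unfolding eval using den by (simp add: field_simps)
  qed
  moreover have "cf_eval (?u @ [?b]) (z / (1 - z)) = cf_eval (?u @ [?b - 1]) z"
  proof -
    have "real_of_int ?b + 1 / (z / (1 - z)) = real_of_int (?b - 1) + 1 / z"
      using z1 z2 by (simp add: field_simps)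
    then show ?thesis by (simp only: cf_eval_append cf_eval.simps)
  qed
  ultimately have "x = cf_eval (0 # ?u @ [?b]) (z / (1 - z))"
    by (simp only: cf_eval.simps) simp
  \<comment> \<open>This is where \<open>z > 1/2\<close> is needed.\<close>
  moreover have "z / (1 - z) > 1" using z1 z2 by simp
  ultimately show ?thesis unfolding x_def by auto
qed

lemma cf_coeff_x_series:
  assumes "b \<ge> 3" "j \<le> 2 ^ (n + 2)"
  shows "cf_coeff (x_series b) j = (0 # (int b - 1) # fold_word (int b) n @ [int b]) ! j"
proof -
  obtain z where z: "z > 1"
    "x_series b = cf_eval (0 # (int b - 1) # fold_word (int b) n @ [int b]) z"
    using x_series_eq_cf_eval[OF assms(1)] by blast
  show ?thesis unfolding z(2)
  proof (rule cf_coeff_cf_eval)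
    show "\<forall>a\<in>set ((int b - 1) # fold_word (int b) n @ [int b]). a \<ge> 1"
      using fold_word_ge_1[of "int b" n] assms(1) by auto
    show "j \<le> length ((int b - 1) # fold_word (int b) n @ [int b])"
      using assms(2) length_fold_word[of "int b" n] by simp
  qed (fact z(1))
qed

lemma cf_coeff_x_series_0_1:
  assumes "b \<ge> 3"
  shows "cf_coeff (x_series b) 0 = 0" "cf_coeff (x_series b) (Suc 0) = int b - 1"
  using cf_coeff_x_series[OF assms, of 0 0] cf_coeff_x_series[OF assms, of "Suc 0" 0] by simp_all

text \<open>
  One folding step reads the letters after position \<open>m\<close> as the mirror image of those before it. The
  only exceptions are the two middle letters, at \<open>m\<close> and \<open>m + 1\<close>.
\<close>

lemma cf_coeff_x_series_reflect:
  fixes b n :: nat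
  defines "m \<equiv> 2 ^ (n + 2)"
  assumes "b \<ge> 3"
  shows "cf_coeff (x_series b) m = int b" "cf_coeff (x_series b) (Suc m) = int b - 2"
    "1 \<le> k \<Longrightarrow> k + 2 \<le> m \<Longrightarrow> cf_coeff (x_series b) (2 * m - k) = cf_coeff (x_series b) (Suc k)"
proof -
  define v where "v = fold_word (int b) n"
  have m: "m = Suc (Suc (length v))" using length_fold_word[of "int b" n] unfolding m_def v_def by linarith
  have coeff_nth: "cf_coeff (x_series b) j = (0 # (int b - 1) # (v @ [int b, int b - 2] @ rev v) @ [int b]) ! j"
    if "j \<le> 2 * m" for j
    using cf_coeff_x_series[OF assms(2), of j "Suc n"] that
    unfolding m_def v_def fold_word.simps by (simp only: add_Suc power_Suc)
  show "cf_coeff (x_series b) m = int b" by (subst coeff_nth) (simp_all add: m nth_append)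
  show "cf_coeff (x_series b) (Suc m) = int b - 2" by (subst coeff_nth) (simp_all add: m nth_append)
  assume k: "1 \<le> k" "k + 2 \<le> m"
  then obtain k' where k': "k = Suc k'" by (cases k) auto
  obtain r where r: "length v = k' + Suc r"
    using k m k' less_imp_Suc_add[of k' "length v"] by auto
  have "cf_coeff (x_series b) (Suc k) = v ! k'"
    using r m by (subst coeff_nth) (simp_all add: k' nth_append)
  moreover have "cf_coeff (x_series b) (2 * m - k) = rev v ! r"
  proof -
    have "2 * m - k = Suc (Suc (length v + Suc (Suc r)))" using m r k' by simp
    moreover have "cf_coeff (x_series b) (2 * m - k) =
        (0 # (int b - 1) # (v @ [int b, int b - 2] @ rev v) @ [int b]) ! (2 * m - k)"
      by (rule coeff_nth) simp
    ultimately have "cf_coeff (x_series b) (2 * m - k) = (rev v @ [int b]) ! r"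
      by (simp only: nth_Cons_Suc append_assoc append_Cons append_Nil nth_append_length_plus)
    then show ?thesis using r by (simp add: nth_append)
  qed
  moreover have "rev v ! r = v ! k'" using r by (simp add: rev_nth)
  ultimately show "cf_coeff (x_series b) (2 * m - k) = cf_coeff (x_series b) (Suc k)"
    by simp
qed

section \<open>Reflected convergents\<close>

text \<open>
  Two continued fractions that share their first \<open>r\<close> partial quotients are exponentially close. One
  step \<open>u \<mapsto> 1/(a + u)\<close> need not contract if \<open>a = 1\<close>, but two steps do, because
  \<open>u 0 * u 1 \<le> 1/2\<close>.
\<close>

lemma cf_reciprocal_sequences_close:
  fixes u v a :: "nat \<Rightarrow> real"
  assumes "\<And>i. i < r \<Longrightarrow> a i \<ge> 1"
    and "\<And>i. i < r \<Longrightarrow> u i * (a i + u (Suc i)) = 1" "\<And>i. i < r \<Longrightarrow> v i * (a i + v (Suc i)) = 1"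
    and "\<And>i. i \<le> r \<Longrightarrow> 0 < u i \<and> u i \<le> 1" "\<And>i. i \<le> r \<Longrightarrow> 0 < v i \<and> v i \<le> 1"
  shows "\<bar>u 0 - v 0\<bar> \<le> 2 * (1 / 2) ^ r"
  using assms
proof (induction r arbitrary: u v a rule: induct_nat_012)
  case 0
  from 0(4)[of 0] 0(5)[of 0] show ?case by (simp add: abs_le_iff)
next
  case 1
  from 1(4)[of 0] 1(5)[of 0] show ?case by (simp add: abs_le_iff)
next
  case (ge2 r)
  have rec: "u 0 * (a 0 + u 1) = 1" "v 0 * (a 0 + v 1) = 1"
            "u 1 * (a 1 + u 2) = 1" "v 1 * (a 1 + v 2) = 1"
    using ge2.prems(2)[of 0] ge2.prems(3)[of 0] ge2.prems(2)[of 1] ge2.prems(3)[of 1]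
    by (simp_all add: numeral_2_eq_2)
  have pos: "0 < u 0" "0 < v 0" "0 < u 1" "0 < v 1" "u 1 \<le> a 0" "v 1 \<le> a 0"
    using ge2.prems(4)[of 0] ge2.prems(4)[of 1] ge2.prems(5)[of 0] ge2.prems(5)[of 1] ge2.prems(1)[of 0]
    by auto
  have "u 0 - v 0 = u 0 * v 0 * (v 1 - u 1)" using rec(1,2) by algebra
  moreover have "v 1 - u 1 = v 1 * u 1 * (u 2 - v 2)" using rec(3,4) by algebra
  ultimately have "\<bar>u 0 - v 0\<bar> = (u 0 * u 1) * (v 0 * v 1) * \<bar>u 2 - v 2\<bar>"
    using pos by (simp add: abs_mult)
  also have "\<dots> \<le> (1 / 2) * (1 / 2) * (2 * (1 / 2) ^ r)"
  proof (intro mult_mono)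
    have "u 0 * u 1 \<le> u 0 * a 0" "v 0 * v 1 \<le> v 0 * a 0" using pos by (auto intro!: mult_left_mono)
    then show "u 0 * u 1 \<le> 1 / 2" "v 0 * v 1 \<le> 1 / 2" using rec(1,2) by (simp_all add: distrib_left)
    show "\<bar>u 2 - v 2\<bar> \<le> 2 * (1 / 2) ^ r"
      using ge2.IH(1)[of "\<lambda>i. a (i + 2)" "\<lambda>i. u (i + 2)" "\<lambda>i. v (i + 2)"] ge2.prems
      by (simp add: numeral_2_eq_2)
  qed (use pos in auto)
  finally show ?case by simp
qed

definition cf_alt_sum :: "real \<Rightarrow> nat \<Rightarrow> int" where
  "cf_alt_sum x k = (\<Sum>j<k. (- 1) ^ j * cf_coeff x (Suc j))"

text \<open>
  Mirrored positions \<open>2 m - k\<close> and \<open>k + 1\<close> have opposite parity, so their letters cancel in the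
  alternating sum. Only the two middle letters \<open>b\<close> and \<open>b - 2\<close>, which enter as
  \<open>- b + (b - 2)\<close>, make a difference.
\<close>

lemma cf_alt_sum_reflect:
  fixes b n k :: nat
  defines "m \<equiv> 2 ^ (n + 2)"
  assumes b: "b \<ge> 3" and k: "1 \<le> k" "k < m"
  shows "cf_alt_sum (x_series b) (2 * m - k) = cf_alt_sum (x_series b) k - 2"
proof -
  note reflect = cf_coeff_x_series_reflect[OF b, where n = n, folded m_def]
  have "even m" by (simp add: m_def)
  have "m \<ge> 4" unfolding m_def by simp
  have "cf_alt_sum (x_series b) (m + 1 + i) = cf_alt_sum (x_series b) (m - 1 - i) - 2" if "i + 2 \<le> m" for i
    using that
  proof (induction i)
    case 0
    obtain m' where m': "m = Suc m'" using \<open>m \<ge> 4\<close> by (cases m) auto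
    then show ?case using reflect(1,2) \<open>even m\<close> by (simp add: cf_alt_sum_def)
  next
    case (Suc i)
    define q where "q = m - 2 - i"
    have q: "m - 1 - i = Suc q" "m - 1 - Suc i = q" "2 * m - q = Suc (m + 1 + i)" "even q \<longleftrightarrow> even i"
      using Suc.prems \<open>even m\<close> by (auto simp: q_def)
    have "cf_coeff (x_series b) (Suc (m + 1 + i)) = cf_coeff (x_series b) (Suc q)"
      using reflect(3)[of q] Suc.prems unfolding q(3) by (auto simp: q_def)
    moreover have "(- 1) ^ (m + 1 + i) = - ((- 1 :: int) ^ q)"
      using q(4) \<open>even m\<close> by (cases "even i") simp_all
    ultimately show ?case using Suc.IH Suc.prems unfolding q by (simp add: cf_alt_sum_def)
  qed
  from this[of "m - 1 - k"] have "cf_alt_sum (x_series b) (m + 1 + (m - 1 - k)) =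
      cf_alt_sum (x_series b) (m - 1 - (m - 1 - k)) - 2" using k by auto
  moreover have "m + 1 + (m - 1 - k) = 2 * m - k" "m - 1 - (m - 1 - k) = k" using k by auto
  ultimately show ?thesis by (simp only:)
qed

text \<open>
  With \<open>K = 2 m - k\<close>, the quotient is the finite continued fraction \<open>[0, a\<^sub>K, \<dots>, a\<^sub>1]\<close>, which by
  reflection begins with the letters \<open>a\<^sub>k\<^sub>+\<^sub>1, \<dots>, a\<^sub>m\<^sub>-\<^sub>1\<close> of the tail.
\<close>

lemma cf_den_ratio_reflect_tendsto:
  fixes b k :: nat
  assumes b: "b \<ge> 3" and k: "k \<ge> 1"
  shows "(\<lambda>n. of_int (cf_den (x_series b) (2 * 2 ^ (n + 2) - k - 1)) /
              of_int (cf_den (x_series b) (2 * 2 ^ (n + 2) - k)))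
           \<longlonglongrightarrow> cf_tail (x_series b) k" (is "?f \<longlonglongrightarrow> _")
proof -
  let ?x = "x_series b"
  have irr: "?x \<notin> \<rat>" using b by (intro x_series_irrational) simp
  have close: "\<bar>?f n - cf_tail ?x k\<bar> \<le> 2 * (1 / 2) ^ (2 ^ (n + 2) - 1 - k)" if n: "k + 2 \<le> 2 ^ (n + 2)" for n
  proof -
    define m K r where "m = (2 ^ (n + 2) :: nat)" and "K = 2 * m - k" and "r = m - 1 - k"
    note reflect = cf_coeff_x_series_reflect(3)[OF b, where n = n, folded m_def]
    define u where "u = (\<lambda>i. of_int (cf_den ?x (K - i - 1)) / of_int (cf_den ?x (K - i)) :: real)"
    have "\<bar>u 0 - cf_tail ?x (k + 0)\<bar> \<le> 2 * (1 / 2) ^ r"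
    proof (rule cf_reciprocal_sequences_close)
      fix i assume i: "i < r"
      have "cf_coeff ?x (2 * m - (k + i)) = cf_coeff ?x (Suc (k + i))"
        using k n i by (intro reflect) (auto simp: r_def m_def)
      then have coeff_eq: "cf_coeff ?x (K - i) = cf_coeff ?x (Suc (k + i))" by (simp add: K_def)
      show "real_of_int (cf_coeff ?x (Suc (k + i))) \<ge> 1"
        using cf_coeff_Suc_ge_1[OF irr, of "k + i"] by simp
      show "cf_tail ?x (k + i) * (real_of_int (cf_coeff ?x (Suc (k + i))) + cf_tail ?x (k + Suc i)) = 1"
        using cf_tail_rec[OF irr, of "k + i"] by simp
      obtain q where q: "K - i = Suc (Suc q)"
      proof -
        have "K - i \<ge> 2" using n i by (auto simp: K_def r_def m_def)
        then show ?thesis using that[of "K - i - 2"] by simp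
      qed
      then have "K - i - 1 = Suc q" "K - Suc i = Suc q" "K - Suc i - 1 = q" by simp_all
      moreover have pos: "cf_den ?x (Suc q) \<ge> 1" "cf_den ?x (Suc (Suc q)) \<ge> 1"
        by (rule cf_den_ge[OF irr])+
      have "of_int (cf_coeff ?x (Suc (Suc q))) + of_int (cf_den ?x q) / of_int (cf_den ?x (Suc q)) =
              (of_int (cf_den ?x (Suc (Suc q))) / of_int (cf_den ?x (Suc q)) :: real)"
        using pos(1) by (simp add: cf_den_simps(3) field_simps)
      ultimately show "u i * (real_of_int (cf_coeff ?x (Suc (k + i))) + u (Suc i)) = 1"
        unfolding u_def coeff_eq[symmetric] q using pos by simp
    next
      fix i assume i: "i \<le> r"
      show "0 < cf_tail ?x (k + i) \<and> cf_tail ?x (k + i) \<le> 1"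
        using cf_tail_bounds[OF irr, of "k + i"] by simp
      obtain q where q: "K - i = Suc (Suc q)"
      proof -
        have "K - i \<ge> 2" using n i by (auto simp: K_def r_def m_def)
        then show ?thesis using that[of "K - i - 2"] by simp
      qed
      have "cf_den ?x (Suc q) < cf_den ?x (Suc (Suc q))" by (rule cf_den_less_Suc[OF irr]) simp
      moreover have "cf_den ?x (Suc q) \<ge> 1" by (rule cf_den_ge[OF irr])
      ultimately show "0 < u i \<and> u i \<le> 1" unfolding u_def q by simp
    qed
    then show ?thesis by (simp add: u_def K_def m_def r_def)
  qed
  have lim: "filterlim (\<lambda>n. 2 ^ (n + 2) - 1 - k) at_top sequentially"
    unfolding filterlim_at_top eventually_sequentially
  proof (intro allI exI impI)
    fix Z n :: nat assume n: "n \<ge> Z + 1 + k"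
    have "n + 2 < 2 ^ (n + 2)" by (rule less_exp)
    then show "Z \<le> 2 ^ (n + 2) - 1 - k" using n by linarith
  qed
  have bound_tendsto: "(\<lambda>n. 2 * (1 / 2 :: real) ^ (2 ^ (n + 2) - 1 - k)) \<longlonglongrightarrow> 0"
    by (intro tendsto_mult_right_zero filterlim_compose[OF LIMSEQ_power_zero lim]) simp
  have bound: "\<forall>\<^sub>F n in sequentially. norm (?f n - cf_tail ?x k) \<le> 2 * (1 / 2) ^ (2 ^ (n + 2) - 1 - k)"
    unfolding eventually_sequentially
  proof (intro exI[of _ k] allI impI)
    fix n assume "n \<ge> k"
    then have "k + 2 \<le> n + 2" by simp
    also have "\<dots> < 2 ^ (n + 2)" by (rule less_exp)
    finally show "norm (?f n - cf_tail ?x k) \<le> 2 * (1 / 2) ^ (2 ^ (n + 2) - 1 - k)"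
      unfolding real_norm_def by (intro close) simp
  qed
  show ?thesis by (rule LIM_zero_cancel[OF Lim_null_comparison[OF bound bound_tendsto]])
qed

text \<open>
  The constant 5 is the 3 of the Barkan-Hickerson-Knuth formula for odd indices plus the 2 lost in
  the reflection; the subsequence consists of the reflections of \<open>k\<close>, which are odd as well.
\<close>

lemma dedekind_S_cluster_point:
  fixes b k :: nat
  assumes b: "b \<ge> 3" and k: "odd k"
  shows "cluster_point (\<lambda>k. dedekind_S (cf_num (x_series b) k) (cf_den (x_series b) k))
           (of_int (cf_alt_sum (x_series b) k) - 5 + x_series b + cf_tail (x_series b) k)"
proof -
  let ?x = "x_series b"
  have irr: "?x \<notin> \<rat>" using b by (intro x_series_irrational) simp
  have k1: "k \<ge> 1" using k by (cases k) auto
  define K where "K = (\<lambda>n. 2 * 2 ^ (n + k + 2) - k)"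
  have k_less: "k < 2 ^ (n + k + 2)" for n
  proof -
    have "k \<le> n + k + 2" by simp
    also have "\<dots> < 2 ^ (n + k + 2)" by (rule less_exp)
    finally show ?thesis .
  qed
  have mono: "strict_mono K"
    unfolding strict_mono_Suc_iff
  proof
    fix n
    show "K n < K (Suc n)" using k_less[of n] by (simp add: K_def)
  qed
  have S: "dedekind_S (cf_num ?x (K n)) (cf_den ?x (K n)) =
      of_int (cf_alt_sum ?x k) - 5 + of_int (cf_num ?x (K n)) / of_int (cf_den ?x (K n))
        + of_int (cf_den ?x (K n - 1)) / of_int (cf_den ?x (K n))" for n
  proof -
    obtain K' where K': "K n = Suc K'" "even K'"
    proof -
      have "odd (K n)" using k k_less[of n] by (simp add: K_def)
      then show ?thesis using that by (cases "K n") auto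
    qed
    have "(\<Sum>j\<le>K'. (- 1 :: real) ^ j) = 1" using K'(2)
    proof (elim evenE)
      fix l assume "K' = 2 * l"
      then show ?thesis by (induction l arbitrary: K') simp_all
    qed
    then have "(\<Sum>j\<le>K'. (- 1) ^ j * (of_int (cf_coeff ?x (Suc j)) - 3)) =
               real_of_int (cf_alt_sum ?x (K n)) - 3"
      unfolding K'(1) cf_alt_sum_def lessThan_Suc_atMost
      by (simp add: right_diff_distrib sum_subtractf flip: sum_distrib_right)
    also have "cf_alt_sum ?x (K n) = cf_alt_sum ?x k - 2"
      unfolding K_def using cf_alt_sum_reflect[OF b k1, of "n + k"] k_less[of n] by simp
    finally show ?thesis
      unfolding K'(1) barkan_hickerson_knuth[OF irr] using K'(2) cf_coeff_x_series_0_1(1)[OF b] by simp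
  qed
  have "(\<lambda>n. of_int (cf_num ?x (K n)) / of_int (cf_den ?x (K n))) \<longlonglongrightarrow> ?x"
    using LIMSEQ_subseq_LIMSEQ[OF convergents_tendsto[OF irr] mono] by (simp add: o_def)
  moreover have "(\<lambda>n. of_int (cf_den ?x (K n - 1)) / of_int (cf_den ?x (K n))) \<longlonglongrightarrow> cf_tail ?x k"
    using LIMSEQ_ignore_initial_segment[OF cf_den_ratio_reflect_tendsto[OF b k1], of k] by (simp add: K_def)
  ultimately have "(\<lambda>n. dedekind_S (cf_num ?x (K n)) (cf_den ?x (K n))) \<longlonglongrightarrow>
      of_int (cf_alt_sum ?x k) - 5 + ?x + cf_tail ?x k"
    unfolding S by (intro tendsto_intros)
  then show ?thesis unfolding cluster_point_def using mono by (auto simp: o_def)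
qed

text \<open>
  Every solution for \<open>d\<close> has infinitely many reflections, which are solutions for \<open>d + 1\<close>; the
  index \<open>1\<close> is a solution for \<open>d = 0\<close>.
\<close>

lemma infinite_odd_alt_sum:
  fixes b d :: nat
  assumes b: "b \<ge> 3" and d: "d \<ge> 1"
  shows "infinite {k. odd k \<and> cf_alt_sum (x_series b) k = int b - 1 - 2 * int d}" (is "infinite (?O d)")
proof -
  have step: "infinite (?O (Suc d))" if "k \<in> ?O d" for d k
  proof -
    have "inj (\<lambda>n. 2 * 2 ^ (n + k + 2) - k :: nat)"
    proof (rule strict_mono_imp_inj_on)
      show "strict_mono (\<lambda>n. 2 * 2 ^ (n + k + 2) - k :: nat)"
        unfolding strict_mono_Suc_iff
      proof
        fix n
        have "n + k + 2 < 2 ^ (n + k + 2)" by (rule less_exp)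
        then show "2 * 2 ^ (n + k + 2) - k < 2 * 2 ^ (Suc n + k + 2) - (k :: nat)" by simp
      qed
    qed
    then have "infinite (range (\<lambda>n. 2 * 2 ^ (n + k + 2) - k :: nat))" by (rule range_inj_infinite)
    moreover have "range (\<lambda>n. 2 * 2 ^ (n + k + 2) - k) \<subseteq> ?O (Suc d)"
    proof safe
      fix n
      have "n + k + 2 < 2 ^ (n + k + 2)" by (rule less_exp)
      then have kl: "k < 2 ^ (n + k + 2)" by simp
      have k: "odd k" "cf_alt_sum (x_series b) k = int b - 1 - 2 * int d" using that by auto
      have "k \<ge> 1" using k(1) by (cases k) auto
      then show "cf_alt_sum (x_series b) (2 * 2 ^ (n + k + 2) - k) = int b - 1 - 2 * int (Suc d)"
        using cf_alt_sum_reflect[OF b, of k "n + k"] kl k(2) by simp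
      assume "even (2 * 2 ^ (n + k + 2) - k)"
      then show False using k(1) kl by simp
    qed
    ultimately show ?thesis using infinite_super by blast
  qed
  have "?O d \<noteq> {}" for d
  proof (induction d)
    case 0
    have "1 \<in> ?O 0" using cf_coeff_x_series_0_1(2)[OF b] by (simp add: cf_alt_sum_def)
    then show ?case by blast
  next
    case (Suc d)
    then obtain k where "k \<in> ?O d" by blast
    from step[OF this] show ?case by (metis finite.emptyI)
  qed
  then obtain k where "k \<in> ?O (d - 1)" by blast
  from step[OF this] d show ?thesis by simp
qed

section \<open>Transcendence and distinctness of the limits\<close>

text \<open>
  Substitute \<open>c = P(x)/Q(x)\<close> into an integer polynomial with root \<open>c\<close> and clear denominators. Since
  \<open>P\<close> has larger degree than \<open>Q\<close>, the term with the highest power of \<open>P\<close> cannot cancel.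
\<close>

lemma algebraic_if_rational_function:
  fixes P Q :: "real poly"
  assumes "\<And>i. coeff P i \<in> \<int>" "\<And>i. coeff Q i \<in> \<int>" "degree Q < degree P"
    and "poly P x = c * poly Q x" "algebraic c"
  shows "algebraic x"
proof -
  obtain p where p: "\<And>i. coeff p i \<in> \<int>" "p \<noteq> 0" "poly p c = 0"
    using assms(5) algebraicE by blast
  let ?n = "degree p"
  define q where "q = (\<Sum>d\<le>?n. smult (coeff p d) (P ^ d * Q ^ (?n - d)))"
  have mult: "coeff (f * g) i \<in> \<int>" if "\<And>i. coeff f i \<in> \<int>" "\<And>i. coeff g i \<in> \<int>" for f g :: "real poly" and i
    unfolding coeff_mult using that by (intro Ints_sum Ints_mult)
  have power: "coeff (f ^ d) i \<in> \<int>" if "\<And>i. coeff f i \<in> \<int>" for f :: "real poly" and d i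
    using that by (induction d arbitrary: i) (auto intro: mult simp: coeff_1)
  have "coeff q i \<in> \<int>" for i
    unfolding q_def coeff_sum coeff_smult using p(1) assms(1,2)
    by (intro Ints_sum Ints_mult mult power) auto
  moreover have "coeff q (?n * degree P) \<noteq> 0"
  proof -
    have small: "coeff (P ^ d * Q ^ (?n - d)) (?n * degree P) = 0" if "d < ?n" for d
    proof (rule coeff_eq_0)
      have "degree (P ^ d * Q ^ (?n - d)) \<le> degree (P ^ d) + degree (Q ^ (?n - d))"
        by (rule degree_mult_le)
      also have "\<dots> \<le> d * degree P + (?n - d) * degree Q"
        using degree_power_le[of P d] degree_power_le[of Q "?n - d"] by (simp add: mult.commute)
      also have "\<dots> < d * degree P + (?n - d) * degree P"
        using assms(3) that by simp
      also have "\<dots> = ?n * degree P" using that by (simp flip: distrib_right)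
      finally show "degree (P ^ d * Q ^ (?n - d)) < ?n * degree P" .
    qed
    have "coeff q (?n * degree P) = (\<Sum>d\<in>{?n}. coeff p d * coeff (P ^ d * Q ^ (?n - d)) (?n * degree P))"
      unfolding q_def coeff_sum coeff_smult by (intro sum.mono_neutral_right) (auto simp: small)
    also have "\<dots> = lead_coeff p * lead_coeff (P ^ ?n)"
    proof -
      have "P \<noteq> 0" using assms(3) by auto
      then show ?thesis by (simp add: degree_power_eq)
    qed
    finally show ?thesis using p(2) assms(3) by (auto simp: lead_coeff_power)
  qed
  then have "q \<noteq> 0" by auto
  moreover have "poly q x = 0"
  proof -
    have "poly q x = (\<Sum>d\<le>?n. coeff p d * c ^ d * poly Q x ^ ?n)"
      unfolding q_def poly_sum
    proof (rule sum.cong[OF refl])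
      fix d assume "d \<in> {..?n}"
      then have "poly Q x ^ ?n = poly Q x ^ d * poly Q x ^ (?n - d)" by (simp flip: power_add)
      then show "poly (smult (coeff p d) (P ^ d * Q ^ (?n - d))) x = coeff p d * c ^ d * poly Q x ^ ?n"
        by (simp add: assms(4) power_mult_distrib)
    qed
    also have "\<dots> = poly p c * poly Q x ^ ?n" by (simp add: poly_altdef sum_distrib_right)
    finally show ?thesis by (simp add: p(3))
  qed
  ultimately show ?thesis by (rule algebraicI)
qed

lemma transcendental_add_cf_tail:
  assumes "\<not> algebraic x" "k \<ge> 1"
  shows "\<not> algebraic (of_int N + x + cf_tail x k)"
proof
  assume alg: "algebraic (of_int N + x + cf_tail x k)"
  have irr: "x \<notin> \<rat>" using assms(1) rat_imp_algebraic by auto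
  obtain l where l: "k = Suc l" using assms(2) by (cases k) auto
  define s s' t t' where "s = cf_num x k" and "s' = cf_num x l" and "t = cf_den x k" and "t' = cf_den x l"
  let ?P = "[:of_int (N * s' - s), of_int (s' + t - N * t'), - of_int t':] :: real poly"
  let ?Q = "[:of_int s', - of_int t':] :: real poly"
  have "t' \<ge> 1" unfolding t'_def by (rule cf_den_ge[OF irr])
  have "algebraic x"
  proof (rule algebraic_if_rational_function[OF _ _ _ _ alg])
    show "coeff ?P i \<in> \<int>" for i by (simp add: coeff_pCons split: nat.split)
    show "coeff ?Q i \<in> \<int>" for i by (simp add: coeff_pCons split: nat.split)
    show "degree ?Q < degree ?P" using \<open>t' \<ge> 1\<close> by simp
    have "cf_tail x k * (of_int s' - x * of_int t') = x * of_int t - of_int s"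
      unfolding l s'_def t'_def t_def s_def by (rule cf_tail_moebius[OF irr])
    then show "poly ?P x = (of_int N + x + cf_tail x k) * poly ?Q x"
      by (simp add: algebra_simps)
  qed
  with assms(1) show False by simp
qed

text \<open>
  Equating the Moebius expressions of two tails gives a quadratic equation for \<open>x\<close>. Its leading
  coefficient is nonzero because the fractions \<open>t\<^sub>k/t\<^sub>k\<^sub>-\<^sub>1\<close> are reduced and have
  distinct numerators.
\<close>

lemma cf_tail_inj:
  assumes "\<not> algebraic x" "1 \<le> k" "k < l"
  shows "cf_tail x k \<noteq> cf_tail x l"
proof
  assume eq: "cf_tail x k = cf_tail x l"
  have irr: "x \<notin> \<rat>" using assms(1) rat_imp_algebraic by auto
  obtain k' where k': "k = Suc k'" using assms(2) by (cases k) auto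
  obtain l' where l': "l = Suc l'" using assms(3) by (cases l) auto
  define s s' t t' where "s = cf_num x k" and "s' = cf_num x k'" and "t = cf_den x k" and "t' = cf_den x k'"
  define p p' q q' where "p = cf_num x l" and "p' = cf_num x l'" and "q = cf_den x l" and "q' = cf_den x l'"
  have pos: "t \<ge> 1" "t' \<ge> 1" "q \<ge> 1" "q' \<ge> 1"
    unfolding t_def t'_def q_def q'_def by (rule cf_den_ge[OF irr])+
  have "t < q" unfolding t_def q_def by (rule cf_den_less[OF irr assms(2,3)])
  have lead: "q * t' - t * q' \<noteq> 0"
  proof
    assume "q * t' - t * q' = 0"
    then have "q dvd t * q'" by (metis dvd_triv_left eq_iff_diff_eq_0)
    moreover have "coprime q q'"
      using coprime_consecutive_cf_den[of x l'] by (simp add: q_def q'_def l' coprime_commute)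
    ultimately have "q dvd t" by (simp add: coprime_dvd_mult_left_iff)
    then show False using \<open>t < q\<close> pos by (simp add: zdvd_not_zless)
  qed
  have "cf_tail x k * (of_int s' - x * of_int t') = x * of_int t - of_int s"
    unfolding k' s'_def t'_def t_def s_def by (rule cf_tail_moebius[OF irr])
  moreover have "cf_tail x k * (of_int p' - x * of_int q') = x * of_int q - of_int p"
    unfolding eq unfolding l' p'_def q'_def q_def p_def by (rule cf_tail_moebius[OF irr])
  ultimately have "(x * of_int t - of_int s) * (of_int p' - x * of_int q') =
      (x * of_int q - of_int p) * (of_int s' - x * of_int t')" by algebra
  then have "poly [:of_int (p * s' - s * p'), of_int (t * p' + s * q' - q * s' - p * t'),
              of_int (q * t' - t * q'):] x = 0"
    by (simp add: algebra_simps)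
  moreover have "[:of_int (p * s' - s * p'), of_int (t * p' + s * q' - q * s' - p * t'),
              of_int (q * t' - t * q'):] \<noteq> (0 :: real poly)"
    using lead by (simp del: of_int_diff of_int_mult)
  moreover have "coeff [:of_int (p * s' - s * p'), of_int (t * p' + s * q' - q * s' - p * t'),
              of_int (q * t' - t * q') :: real:] i \<in> \<int>" for i
    by (simp add: coeff_pCons split: nat.split)
  ultimately have "algebraic x" by (intro algebraicI) auto
  with assms(1) show False by simp
qed

theorem theorem1:
  fixes b i :: nat
  assumes "b \<ge> 3"
  shows "infinite {c :: real.
           cluster_point (\<lambda>k. dedekind_S (cf_num (x_series b) k) (cf_den (x_series b) k)) c \<and>
           \<not> algebraic c \<and>
           c \<in> {real b - 10 - 2 * real i + 1 / real b
                <..< real b - 9 - 2 * real i + 1 / (real b - 1)}}"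
    (is "infinite ?C")
proof -
  let ?x = "x_series b"
  define J where "J = {k. odd k \<and> cf_alt_sum ?x k = int b - 1 - 2 * int (i + 2)}"
  define c where "c = (\<lambda>k. of_int (cf_alt_sum ?x k) - 5 + ?x + cf_tail ?x k)"
  have trans: "\<not> algebraic ?x" using assms by (intro x_series_transcendental) simp
  then have irr: "?x \<notin> \<rat>" using rat_imp_algebraic by auto
  have J_ge_1: "k \<ge> 1" if "k \<in> J" for k using that by (cases k) (auto simp: J_def)
  have c: "c k = of_int (int b - 10 - 2 * int i) + ?x + cf_tail ?x k" if "k \<in> J" for k
    using that by (simp add: J_def c_def)
  have x_bounds: "1 / real b < ?x" "?x < 1 / (real b - 1)"
  proof -
    have z: "0 < 1 / real b" "1 / real b < 1" using assms by simp_all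
    show "1 / real b < ?x" unfolding x_series_altdef by (rule power2_series(2)[OF z])
    have "?x \<le> 1 / real b / (1 - 1 / real b)" unfolding x_series_altdef by (rule power2_series(3)[OF z])
    also have "\<dots> = 1 / (real b - 1)" using assms by (simp add: field_simps)
    finally have "?x \<le> 1 / (real b - 1)" .
    moreover have "1 / (real b - 1) \<in> \<rat>" by simp
    ultimately show "?x < 1 / (real b - 1)" using irr by (metis order_le_less)
  qed
  have "infinite J" unfolding J_def using assms by (intro infinite_odd_alt_sum) auto
  moreover have "inj_on c J"
  proof (rule inj_onI, rule ccontr)
    fix k l assume kl: "k \<in> J" "l \<in> J" "c k = c l" "k \<noteq> l"
    then have "cf_tail ?x k = cf_tail ?x l" by (simp add: c)
    then show False
      using cf_tail_inj[OF trans] J_ge_1 kl by (metis linorder_neqE_nat)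
  qed
  ultimately have "infinite (c ` J)" by (simp add: finite_image_iff)
  moreover have "c ` J \<subseteq> ?C"
  proof (rule image_subsetI, rule CollectI, intro conjI)
    fix k assume k: "k \<in> J"
    show "cluster_point (\<lambda>k. dedekind_S (cf_num ?x k) (cf_den ?x k)) (c k)"
      unfolding c_def using k by (intro dedekind_S_cluster_point assms) (simp add: J_def)
    show "\<not> algebraic (c k)" unfolding c[OF k] by (rule transcendental_add_cf_tail[OF trans J_ge_1[OF k]])
    show "c k \<in> {real b - 10 - 2 * real i + 1 / real b <..< real b - 9 - 2 * real i + 1 / (real b - 1)}"
      unfolding c[OF k] using x_bounds cf_tail_bounds[OF irr, of k] by simp
  qed
  ultimately show ?thesis using infinite_super by blast
qed

end
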